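(* Let $\gamma_1\subsetneq\sigma\subset\gamma_2$ be cones in $\Sigma$ and let $k=\dim\sigma$. Then there are cones $\sigma_i$ of dimension $k$ in $\Sigma$ with $\gamma_1\subset\sigma_i$ and $\sigma_i\nsubseteq\gamma_2$, and integers $m_i$, such that $$P(\sigma)=\sum_im_iP(\sigma_i)\in\mathcal H_f.$$
   Context: $N\cong\mathbb Z^n$, $M=\mathrm{Hom}(N,\mathbb Z)$; $\Sigma\subset N\otimes\mathbb R$ is a smooth complete fan whose toric variety $Y$ is projective. $\rho_1,\dots,\rho_d\in N$ are the primitive ray generators, numbered so that $\rho_1,\dots,\rho_n$ is a basis of $N$ and spans a maximal cone; $e^1,\dots,e^n\in M$ is the dual basis. For a cone $\tau\in\Sigma$ with generating rays $\rho_{i_1},\dots,\rho_{i_k}$, $P(\tau)=z_{i_1}\cdots z_{i_k}$ ($P(\{0\})=1$). $X\subset\mathbb C^d$ is the analytic space defined by the Stanley-Reisner ideal of $\Sigma$ (generated by the products $z_{i_1}\cdots z_{i_p}$ such that $\rho_{i_1},\dots,\rho_{i_p}$ do not lie in a common cone). The relative log derivations $\Theta^1$ of its natural log structure form a free $\mathcal O_X$-module with frame $\tilde\theta_k=\sum_{i=1}^d\langle\rho_i,e^k\rangle z_i\partial/\partial z_i$, $k=1,\dots,n$; $\Theta^i=\wedge^i\Theta^1$. $f=z_1+\dots+z_d$. With $\partial/\partial\tilde\theta_k$ the $\mathcal O_X$-linear odd derivations of $\Theta^\bullet$ dual to the frame, $\{f,-\}=\sum_k\tilde\theta_k(f)\,\partial/\partial\tilde\theta_k$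 and $\partial=\sum_k\tilde\theta_k\circ\partial/\partial\tilde\theta_k$ ($\tilde\theta_k$ acting as a vector field on coefficients). The Brieskorn lattice $\mathcal H_f$ is the cohomology of $(\Gamma(X,\Theta^\bullet)[[u]],\{f,-\}+u\partial)$ ($u$ a formal variable; equivalently of its smooth Dolbeault version), concentrated in $\Theta$-degree $0$; monomials in the $z_i$ denote their classes in it. *)

theory Defs
  imports "HOL-Analysis.Analysis" "HOL-Algebra.QuotRing"
begin

section \<open>Lattices, cones and fans\<close>

text \<open>The lattice \<open>N\<close> is \<open>int ^ 'n\<close>, its real span is \<open>real ^ 'n\<close>, and \<open>M = Hom(N, Z)\<close>.\<close>

type_synonym 'n lattice = "(int, 'n) vec"

type_synonym 'n cone = "(real, 'n) vec set"

definition real_vec :: "int ^ 'n \<Rightarrow> real ^ 'n"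
  where "real_vec v = (\<chi> j. real_of_int (v $ j))"

definition M_lattice :: "(int ^ 'n \<Rightarrow> int) set"
  where "M_lattice = {m. Modules.additive m}"

definition pairing :: "(int ^ 'n \<Rightarrow> int) \<Rightarrow> real ^ 'n \<Rightarrow> real"
  where "pairing m v = (\<Sum>j\<in>UNIV. real_of_int (m (axis j 1)) * v $ j)"

definition lattice_basis :: "('n \<Rightarrow> int ^ 'n) \<Rightarrow> bool"
  where "lattice_basis \<beta> \<longleftrightarrow> (\<forall>v. \<exists>!c :: 'n \<Rightarrow> int. v = (\<Sum>j\<in>UNIV. c j *s \<beta> j))"

definition primitive :: "int ^ 'n \<Rightarrow> bool"
  where "primitive v \<longleftrightarrow> v \<noteq> 0 \<and> (\<forall>(c::int) w. v = c *s w \<longrightarrow> \<bar>c\<bar> = 1)"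

definition rational_polyhedral_cone :: "(real ^ 'n) set \<Rightarrow> bool"
  where "rational_polyhedral_cone \<sigma> \<longleftrightarrow> (\<exists>S. finite S \<and> \<sigma> = convex_cone hull (real_vec ` S))"

definition strongly_convex :: "(real ^ 'n) set \<Rightarrow> bool"
  where "strongly_convex \<sigma> \<longleftrightarrow> \<sigma> \<inter> uminus ` \<sigma> = {0}"

text \<open>The library's \<^const>\<open>face_of\<close> also counts the empty set as a face; faces of a cone are the
  nonempty ones.\<close>

definition cone_face :: "(real ^ 'n) set \<Rightarrow> (real ^ 'n) set \<Rightarrow> bool"
  where "cone_face \<tau> \<sigma> \<longleftrightarrow> \<tau> face_of \<sigma> \<and> \<tau> \<noteq> {}"

definition fan :: "(real ^ 'n) set set \<Rightarrow> bool"
  where "fan \<Sigma> \<longleftrightarrow> finite \<Sigma> \<and> \<Sigma> \<noteq> {} \<and>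
    (\<forall>\<sigma>\<in>\<Sigma>. rational_polyhedral_cone \<sigma> \<and> strongly_convex \<sigma>) \<and>
    (\<forall>\<sigma>\<in>\<Sigma>. \<forall>\<tau>. cone_face \<tau> \<sigma> \<longrightarrow> \<tau> \<in> \<Sigma>) \<and>
    (\<forall>\<sigma>\<in>\<Sigma>. \<forall>\<sigma>'\<in>\<Sigma>. cone_face (\<sigma> \<inter> \<sigma>') \<sigma> \<and> cone_face (\<sigma> \<inter> \<sigma>') \<sigma>')"

definition smooth_cone :: "(real ^ 'n) set \<Rightarrow> bool"
  where "smooth_cone \<sigma> \<longleftrightarrow>
    (\<exists>\<beta> J. lattice_basis \<beta> \<and> \<sigma> = convex_cone hull (real_vec ` \<beta> ` J))"

definition smooth_fan :: "(real ^ 'n) set set \<Rightarrow> bool"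
  where "smooth_fan \<Sigma> \<longleftrightarrow> fan \<Sigma> \<and> (\<forall>\<sigma>\<in>\<Sigma>. smooth_cone \<sigma>)"

definition complete_fan :: "(real ^ 'n) set set \<Rightarrow> bool"
  where "complete_fan \<Sigma> \<longleftrightarrow> fan \<Sigma> \<and> \<Union>\<Sigma> = UNIV"

definition primitive_ray_generators :: "(real ^ 'n) set set \<Rightarrow> (int ^ 'n) set"
  where "primitive_ray_generators \<Sigma> = {v. primitive v \<and> convex_cone hull {real_vec v} \<in> \<Sigma>}"


section \<open>Spaces with functions and projectivity of a toric variety\<close>

text \<open>Complex varieties in the classical sense: a set of points, its Zariski open subsets, and for
  every open set the regular functions on it.  Functions are total; regularity on \<open>W\<close> only depends
  on the values on \<open>W\<close>.\<close>

record 'p space_with_functions =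
  points :: "'p set"
  opens :: "'p set set"
  regular :: "'p set \<Rightarrow> ('p \<Rightarrow> complex) set"

definition closed_subvariety ::
    "'p space_with_functions \<Rightarrow> 'p set \<Rightarrow> 'p space_with_functions"
  where "closed_subvariety V Z = \<lparr>points = Z, opens = {W \<inter> Z |W. W \<in> opens V},
    regular = (\<lambda>W'. {g. \<forall>p\<in>W'. \<exists>W\<in>opens V. p \<in> W \<and> (\<exists>h\<in>regular V W. \<forall>q\<in>W \<inter> W'. g q = h q)})\<rparr>"

definition isomorphic_varieties ::
    "'p space_with_functions \<Rightarrow> 'q space_with_functions \<Rightarrow> bool"
  where "isomorphic_varieties V V' \<longleftrightarrow> (\<exists>\<phi>. bij_betw \<phi> (points V) (points V') \<and>
    (\<forall>W. W \<subseteq> points V \<longrightarrow> (W \<in> opens V \<longleftrightarrow> \<phi> ` W \<in> opens V')) \<and>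
    (\<forall>W\<in>opens V. \<forall>g. g \<circ> \<phi> \<in> regular V W \<longleftrightarrow> g \<in> regular V' (\<phi> ` W)))"

text \<open>Homogeneous polynomials of degree \<open>l\<close> in the variables \<open>x\<^sub>0, \<dots>, x\<^sub>r\<close>, as functions.\<close>

definition homogeneous_polys :: "nat \<Rightarrow> nat \<Rightarrow> ((nat \<Rightarrow> complex) \<Rightarrow> complex) set"
  where "homogeneous_polys r l = {a. \<exists>A c. finite A \<and> (\<forall>\<alpha>\<in>A. (\<Sum>i\<le>r. \<alpha> i) = l) \<and>
    a = (\<lambda>x. \<Sum>\<alpha>\<in>A. c \<alpha> * (\<Prod>i\<le>r. x i ^ \<alpha> i))}"

text \<open>A point of projective \<open>r\<close>-space is the set of all its homogeneous coordinate vectors.\<close>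

definition projective_points :: "nat \<Rightarrow> (nat \<Rightarrow> complex) set set"
  where "projective_points r = {x. (\<exists>i. x i \<noteq> 0) \<and> (\<forall>i>r. x i = 0)} //
    {(x, y). \<exists>c. c \<noteq> 0 \<and> y = (\<lambda>i. c * x i)}"

definition projective_space :: "nat \<Rightarrow> (nat \<Rightarrow> complex) set space_with_functions"
  where "projective_space r = \<lparr>points = projective_points r,
    opens = {W. \<exists>A \<subseteq> (\<Union>l. homogeneous_polys r l).
      W = {p \<in> projective_points r. \<exists>a\<in>A. \<forall>x\<in>p. a x \<noteq> 0}},
    regular = (\<lambda>W. {g. \<forall>p\<in>W. \<exists>l. \<exists>a\<in>homogeneous_polys r l. \<exists>b\<in>homogeneous_polys r l.
      (\<forall>x\<in>p. b x \<noteq> 0) \<and> (\<forall>q\<in>W. \<forall>x\<in>q. b x \<noteq> 0 \<longrightarrow> g q = a x / b x)})\<rparr>"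

definition projective_variety :: "'p space_with_functions \<Rightarrow> bool"
  where "projective_variety V \<longleftrightarrow> (\<exists>r Z. Z \<subseteq> projective_points r \<and>
    projective_points r - Z \<in> opens (projective_space r) \<and>
    isomorphic_varieties V (closed_subvariety (projective_space r) Z))"

text \<open>The affine chart of a cone \<open>\<sigma>\<close> is the spectrum of the semigroup algebra of
  \<open>\<sigma>\<^sup>\<or> \<inter> M\<close>; its points are the semigroup homomorphisms \<open>\<sigma>\<^sup>\<or> \<inter> M \<rightarrow> (\<complex>, \<cdot>)\<close>, and its coordinate ring
  consists of the linear combinations of characters.\<close>

definition dual_semigroup :: "(real ^ 'n) set \<Rightarrow> (int ^ 'n \<Rightarrow> int) set"
  where "dual_semigroup \<sigma> = {m \<in> M_lattice. \<forall>v\<in>\<sigma>. 0 \<le> pairing m v}"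

definition toric_chart :: "(real ^ 'n) set \<Rightarrow> ((int ^ 'n \<Rightarrow> int) \<Rightarrow> complex) set"
  where "toric_chart \<sigma> = {x \<in> extensional (dual_semigroup \<sigma>). x (\<lambda>v. 0) = 1 \<and>
    (\<forall>m\<in>dual_semigroup \<sigma>. \<forall>m'\<in>dual_semigroup \<sigma>. x (\<lambda>v. m v + m' v) = x m * x m')}"

definition toric_coordinate_ring ::
    "(real ^ 'n) set \<Rightarrow> (((int ^ 'n \<Rightarrow> int) \<Rightarrow> complex) \<Rightarrow> complex) set"
  where "toric_coordinate_ring \<sigma> = {a. \<exists>F c. finite F \<and> F \<subseteq> dual_semigroup \<sigma> \<and>
    a = (\<lambda>x. \<Sum>m\<in>F. c m * x m)}"

text \<open>The charts of \<open>\<sigma>\<close> and \<open>\<sigma>'\<close> are glued along the chart of the common face \<open>\<sigma> \<inter> \<sigma>'\<close>, which is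
  mapped to them by restriction of semigroup homomorphisms.\<close>

definition toric_glue :: "(real ^ 'n) set set \<Rightarrow>
    (((real ^ 'n) set \<times> ((int ^ 'n \<Rightarrow> int) \<Rightarrow> complex)) \<times>
     ((real ^ 'n) set \<times> ((int ^ 'n \<Rightarrow> int) \<Rightarrow> complex))) set"
  where "toric_glue \<Sigma> = {((\<sigma>, x), (\<sigma>', x')). \<sigma> \<in> \<Sigma> \<and> \<sigma>' \<in> \<Sigma> \<and>
    x \<in> toric_chart \<sigma> \<and> x' \<in> toric_chart \<sigma>' \<and>
    (\<exists>y\<in>toric_chart (\<sigma> \<inter> \<sigma>').
      x = restrict y (dual_semigroup \<sigma>) \<and> x' = restrict y (dual_semigroup \<sigma>'))}"

definition toric_point :: "(real ^ 'n) set set \<Rightarrow> (real ^ 'n) set \<Rightarrow>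
    ((int ^ 'n \<Rightarrow> int) \<Rightarrow> complex) \<Rightarrow> ((real ^ 'n) set \<times> ((int ^ 'n \<Rightarrow> int) \<Rightarrow> complex)) set"
  where "toric_point \<Sigma> \<sigma> x = toric_glue \<Sigma> `` {(\<sigma>, x)}"

definition toric_variety :: "(real ^ 'n) set set \<Rightarrow>
    ((real ^ 'n) set \<times> ((int ^ 'n \<Rightarrow> int) \<Rightarrow> complex)) set space_with_functions"
  where "toric_variety \<Sigma> = \<lparr>points = Sigma \<Sigma> toric_chart // toric_glue \<Sigma>,
    opens = {W. W \<subseteq> Sigma \<Sigma> toric_chart // toric_glue \<Sigma> \<and>
      (\<forall>\<sigma>\<in>\<Sigma>. \<exists>A \<subseteq> toric_coordinate_ring \<sigma>.
        {x \<in> toric_chart \<sigma>. toric_point \<Sigma> \<sigma> x \<in> W} = {x \<in> toric_chart \<sigma>. \<exists>a\<in>A. a x \<noteq> 0})},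
    regular = (\<lambda>W. {g. \<forall>\<sigma>\<in>\<Sigma>. \<forall>x\<in>toric_chart \<sigma>. toric_point \<Sigma> \<sigma> x \<in> W \<longrightarrow>
      (\<exists>a\<in>toric_coordinate_ring \<sigma>. \<exists>b\<in>toric_coordinate_ring \<sigma>. b x \<noteq> 0 \<and>
        (\<forall>y\<in>toric_chart \<sigma>. toric_point \<Sigma> \<sigma> y \<in> W \<and> b y \<noteq> 0 \<longrightarrow>
          g (toric_point \<Sigma> \<sigma> y) = a y / b y))})\<rparr>"


section \<open>The Stanley-Reisner analytic space\<close>

text \<open>\<open>\<complex>\<^sup>d\<close> is \<open>complex ^ 'd\<close>, where \<open>'d\<close> indexes the rays of the fan.\<close>

definition slice :: "complex ^ 'd \<Rightarrow> 'd \<Rightarrow> complex \<Rightarrow> complex ^ 'd"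
  where "slice z i w = (\<chi> j. if j = i then w else z $ j)"

definition partial_deriv :: "'d \<Rightarrow> (complex ^ 'd \<Rightarrow> complex) \<Rightarrow> complex ^ 'd \<Rightarrow> complex"
  where "partial_deriv i h z = deriv (\<lambda>w. h (slice z i w)) (z $ i)"

text \<open>Holomorphic functions of several variables on an open set: continuous and holomorphic in each
  variable separately.\<close>

definition holomorphic_several :: "(complex ^ 'd \<Rightarrow> complex) \<Rightarrow> (complex ^ 'd) set \<Rightarrow> bool"
  where "holomorphic_several h U \<longleftrightarrow> continuous_on U h \<and>
    (\<forall>z\<in>U. \<forall>i. (\<lambda>w. h (slice z i w)) field_differentiable (at (z $ i)))"

definition SR_nonfaces :: "(real ^ 'n) set set \<Rightarrow> ('d \<Rightarrow> int ^ 'n) \<Rightarrow> 'd set set"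
  where "SR_nonfaces \<Sigma> \<rho> = {I. \<not> (\<exists>\<sigma>\<in>\<Sigma>. \<forall>i\<in>I. real_vec (\<rho> i) \<in> \<sigma>)}"

definition X_space :: "(real ^ 'n) set set \<Rightarrow> ('d::finite \<Rightarrow> int ^ 'n) \<Rightarrow> (complex ^ 'd) set"
  where "X_space \<Sigma> \<rho> = {z. \<forall>I\<in>SR_nonfaces \<Sigma> \<rho>. (\<Prod>i\<in>I. z $ i) = 0}"

text \<open>The local ring of \<open>\<complex>\<^sup>d\<close> at \<open>p\<close> is represented by the ring of all functions that are holomorphic
  near \<open>p\<close>.  These are not identified when they agree near \<open>p\<close>; since \<open>SR_ideal \<Sigma> \<rho> p\<close> contains the
  functions vanishing near \<open>p\<close>, the quotient \<open>X_stalk \<Sigma> \<rho> p\<close> is nevertheless the stalk at \<open>p\<close> of the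
  sheaf \<open>\<O>/\<I>\<close>, where \<open>\<I>\<close> is the ideal sheaf generated by the Stanley-Reisner monomials.\<close>

definition germ_ring :: "complex ^ 'd \<Rightarrow> (complex ^ 'd::finite \<Rightarrow> complex) ring"
  where "germ_ring p = \<lparr>carrier = {h. \<exists>U. open U \<and> p \<in> U \<and> holomorphic_several h U},
    mult = (\<lambda>g h z. g z * h z), one = (\<lambda>z. 1), zero = (\<lambda>z. 0), add = (\<lambda>g h z. g z + h z)\<rparr>"

definition SR_ideal :: "(real ^ 'n) set set \<Rightarrow> ('d::finite \<Rightarrow> int ^ 'n) \<Rightarrow> complex ^ 'd \<Rightarrow>
    (complex ^ 'd \<Rightarrow> complex) set"
  where "SR_ideal \<Sigma> \<rho> p = {g. \<exists>U h. open U \<and> p \<in> U \<and>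
    (\<forall>I\<in>SR_nonfaces \<Sigma> \<rho>. holomorphic_several (h I) U) \<and>
    (\<forall>z\<in>U. g z = (\<Sum>I\<in>SR_nonfaces \<Sigma> \<rho>. h I z * (\<Prod>i\<in>I. z $ i)))}"

definition X_stalk :: "(real ^ 'n) set set \<Rightarrow> ('d::finite \<Rightarrow> int ^ 'n) \<Rightarrow> complex ^ 'd \<Rightarrow>
    (complex ^ 'd \<Rightarrow> complex) set ring"
  where "X_stalk \<Sigma> \<rho> p = germ_ring p Quot SR_ideal \<Sigma> \<rho> p"

definition X_germ :: "(real ^ 'n) set set \<Rightarrow> ('d::finite \<Rightarrow> int ^ 'n) \<Rightarrow> complex ^ 'd \<Rightarrow>
    (complex ^ 'd \<Rightarrow> complex) \<Rightarrow> (complex ^ 'd \<Rightarrow> complex) set"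
  where "X_germ \<Sigma> \<rho> p h = SR_ideal \<Sigma> \<rho> p +>\<^bsub>germ_ring p\<^esub> h"

text \<open>The ring \<open>\<Gamma>(X, \<O>\<^sub>X)\<close>: families of elements of the stalks that are locally induced by a
  holomorphic function.\<close>

type_synonym 'd X_section = "(complex, 'd) vec \<Rightarrow> ((complex, 'd) vec \<Rightarrow> complex) set"

definition X_functions :: "(real ^ 'n) set set \<Rightarrow> ('d::finite \<Rightarrow> int ^ 'n) \<Rightarrow> 'd X_section ring"
  where "X_functions \<Sigma> \<rho> = \<lparr>
    carrier = {s \<in> extensional (X_space \<Sigma> \<rho>). \<forall>p\<in>X_space \<Sigma> \<rho>. \<exists>U h. open U \<and> p \<in> U \<and>
      holomorphic_several h U \<and> (\<forall>q\<in>U \<inter> X_space \<Sigma> \<rho>. s q = X_germ \<Sigma> \<rho> q h)},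
    mult = (\<lambda>s t. \<lambda>p\<in>X_space \<Sigma> \<rho>. s p \<otimes>\<^bsub>X_stalk \<Sigma> \<rho> p\<^esub> t p),
    one = (\<lambda>p\<in>X_space \<Sigma> \<rho>. \<one>\<^bsub>X_stalk \<Sigma> \<rho> p\<^esub>),
    zero = (\<lambda>p\<in>X_space \<Sigma> \<rho>. \<zero>\<^bsub>X_stalk \<Sigma> \<rho> p\<^esub>),
    add = (\<lambda>s t. \<lambda>p\<in>X_space \<Sigma> \<rho>. s p \<oplus>\<^bsub>X_stalk \<Sigma> \<rho> p\<^esub> t p)\<rparr>"

definition X_restrict :: "(real ^ 'n) set set \<Rightarrow> ('d::finite \<Rightarrow> int ^ 'n) \<Rightarrow>
    (complex ^ 'd \<Rightarrow> complex) \<Rightarrow> 'd X_section"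
  where "X_restrict \<Sigma> \<rho> h = (\<lambda>p\<in>X_space \<Sigma> \<rho>. X_germ \<Sigma> \<rho> p h)"


section \<open>Log polyvector fields and the Brieskorn lattice\<close>

text \<open>The frame vector field \<open>\<theta>\<^sub>k = \<Sum>\<^sub>i \<langle>\<rho>\<^sub>i, e\<^sup>k\<rangle> z\<^sub>i \<partial>/\<partial>z\<^sub>i\<close> attached to an element
  \<open>e\<^sup>k\<close> of \<open>M\<close>, on \<open>\<complex>\<^sup>d\<close> and on \<open>\<Gamma>(X, \<O>\<^sub>X)\<close>.  It maps the Stanley-Reisner ideal to itself, so
  that all representatives \<open>h\<close> in \<open>s p\<close> give the same element of the stalk.\<close>

definition log_field :: "('d::finite \<Rightarrow> 'n::finite lattice) \<Rightarrow> ('n lattice \<Rightarrow> int) \<Rightarrow>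
    (complex ^ 'd \<Rightarrow> complex) \<Rightarrow> complex ^ 'd \<Rightarrow> complex"
  where "log_field \<rho> m h z = (\<Sum>i\<in>UNIV. of_int (m (\<rho> i)) * z $ i * partial_deriv i h z)"

definition X_log_field :: "'n::finite cone set \<Rightarrow> ('d::finite \<Rightarrow> 'n lattice) \<Rightarrow> ('n lattice \<Rightarrow> int) \<Rightarrow>
    'd X_section \<Rightarrow> 'd X_section"
  where "X_log_field \<Sigma> \<rho> m s = (\<lambda>p\<in>X_space \<Sigma> \<rho>. \<Union>h\<in>s p. X_germ \<Sigma> \<rho> p (log_field \<rho> m h))"

text \<open>As \<open>\<Theta>\<^sup>1\<close> is free with frame \<open>\<theta>\<^sub>k\<close>, an element \<open>A\<close> of \<open>\<Gamma>(X, \<Theta>\<^sup>\<bullet>)\<close> is given by its coefficients: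
  \<open>A = \<Sum>\<^sub>S A(S) \<theta>\<^sub>S\<close>, where \<open>\<theta>\<^sub>S = \<theta>\<^bsub>k\<^sub>1\<^esub> \<and> \<dots> \<and> \<theta>\<^bsub>k\<^sub>p\<^esub>\<close> for
  \<open>S = {k\<^sub>1 < \<dots> < k\<^sub>p}\<close>.  The frame derivation below is \<open>\<partial>/\<partial>\<theta>\<^sub>k\<close>; if \<open>k\<close> is not in \<open>S\<close> and \<open>r\<close> is the
  number of elements of \<open>S\<close> below \<open>k\<close>, it maps \<open>\<theta>\<^bsub>S\<union>{k}\<^esub> = (-1)\<^sup>r \<theta>\<^sub>k \<and> \<theta>\<^sub>S\<close> to \<open>(-1)\<^sup>r \<theta>\<^sub>S\<close>.\<close>

type_synonym ('d, 'n) polyvector = "'n set \<Rightarrow> 'd X_section"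

definition frame_derivation :: "'n::{finite,linorder} cone set \<Rightarrow>
    ('d::finite \<Rightarrow> 'n lattice) \<Rightarrow> 'n \<Rightarrow> ('d, 'n) polyvector \<Rightarrow> ('d, 'n) polyvector"
  where "frame_derivation \<Sigma> \<rho> k A = (\<lambda>S.
    if k \<in> S then \<zero>\<^bsub>X_functions \<Sigma> \<rho>\<^esub>
    else if even (card {j\<in>S. j < k}) then A (insert k S)
    else \<ominus>\<^bsub>X_functions \<Sigma> \<rho>\<^esub> A (insert k S))"

definition bracket :: "'n::{finite,linorder} cone set \<Rightarrow> ('d::finite \<Rightarrow> 'n lattice) \<Rightarrow>
    ('n \<Rightarrow> 'n lattice \<Rightarrow> int) \<Rightarrow> 'd X_section \<Rightarrow>
    ('d, 'n) polyvector \<Rightarrow> ('d, 'n) polyvector"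
  where "bracket \<Sigma> \<rho> e f A = (\<lambda>S. finsum (X_functions \<Sigma> \<rho>)
    (\<lambda>k. X_log_field \<Sigma> \<rho> (e k) f \<otimes>\<^bsub>X_functions \<Sigma> \<rho>\<^esub> frame_derivation \<Sigma> \<rho> k A S) UNIV)"

definition BV_operator :: "'n::{finite,linorder} cone set \<Rightarrow> ('d::finite \<Rightarrow> 'n lattice) \<Rightarrow>
    ('n \<Rightarrow> 'n lattice \<Rightarrow> int) \<Rightarrow> ('d, 'n) polyvector \<Rightarrow> ('d, 'n) polyvector"
  where "BV_operator \<Sigma> \<rho> e A = (\<lambda>S. finsum (X_functions \<Sigma> \<rho>)
    (\<lambda>k. X_log_field \<Sigma> \<rho> (e k) (frame_derivation \<Sigma> \<rho> k A S)) UNIV)"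

text \<open>The additive group of \<open>\<Gamma>(X, \<Theta>\<^sup>\<bullet>)[[u]]\<close>, written multiplicatively as usual for the quotients
  of \<^const>\<open>FactGroup\<close>: \<open>a j\<close> is the coefficient of \<open>u\<^sup>j\<close>.\<close>

definition polyvector_series :: "'n::{finite,linorder} cone set \<Rightarrow>
    ('d::finite \<Rightarrow> 'n lattice) \<Rightarrow> (nat \<Rightarrow> ('d, 'n) polyvector) monoid"
  where "polyvector_series \<Sigma> \<rho> = \<lparr>carrier = {a. \<forall>j S. a j S \<in> carrier (X_functions \<Sigma> \<rho>)},
    mult = (\<lambda>a b j S. a j S \<oplus>\<^bsub>X_functions \<Sigma> \<rho>\<^esub> b j S),
    one = (\<lambda>j S. \<zero>\<^bsub>X_functions \<Sigma> \<rho>\<^esub>)\<rparr>"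

definition twisted_differential :: "'n::{finite,linorder} cone set \<Rightarrow>
    ('d::finite \<Rightarrow> 'n lattice) \<Rightarrow> ('n \<Rightarrow> 'n lattice \<Rightarrow> int) \<Rightarrow>
    'd X_section \<Rightarrow> (nat \<Rightarrow> ('d, 'n) polyvector) \<Rightarrow> nat \<Rightarrow> ('d, 'n) polyvector"
  where "twisted_differential \<Sigma> \<rho> e f a = (\<lambda>j S. bracket \<Sigma> \<rho> e f (a j) S \<oplus>\<^bsub>X_functions \<Sigma> \<rho>\<^esub>
    (case j of 0 \<Rightarrow> \<zero>\<^bsub>X_functions \<Sigma> \<rho>\<^esub> | Suc i \<Rightarrow> BV_operator \<Sigma> \<rho> e (a i) S))"

definition degree_chains :: "'n::{finite,linorder} cone set \<Rightarrow>
    ('d::finite \<Rightarrow> 'n lattice) \<Rightarrow> nat \<Rightarrow> (nat \<Rightarrow> ('d, 'n) polyvector) set"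
  where "degree_chains \<Sigma> \<rho> q = {a \<in> carrier (polyvector_series \<Sigma> \<rho>).
    \<forall>j S. card S \<noteq> q \<longrightarrow> a j S = \<zero>\<^bsub>X_functions \<Sigma> \<rho>\<^esub>}"

definition degree_cycles :: "'n::{finite,linorder} cone set \<Rightarrow>
    ('d::finite \<Rightarrow> 'n lattice) \<Rightarrow> ('n \<Rightarrow> 'n lattice \<Rightarrow> int) \<Rightarrow>
    'd X_section \<Rightarrow> nat \<Rightarrow> (nat \<Rightarrow> ('d, 'n) polyvector) set"
  where "degree_cycles \<Sigma> \<rho> e f q = {a \<in> degree_chains \<Sigma> \<rho> q.
    twisted_differential \<Sigma> \<rho> e f a = \<one>\<^bsub>polyvector_series \<Sigma> \<rho>\<^esub>}"

text \<open>The differential lowers the \<open>\<Theta>\<close>-degree by one.\<close>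

definition degree_boundaries :: "'n::{finite,linorder} cone set \<Rightarrow>
    ('d::finite \<Rightarrow> 'n lattice) \<Rightarrow> ('n \<Rightarrow> 'n lattice \<Rightarrow> int) \<Rightarrow>
    'd X_section \<Rightarrow> nat \<Rightarrow> (nat \<Rightarrow> ('d, 'n) polyvector) set"
  where "degree_boundaries \<Sigma> \<rho> e f q =
    twisted_differential \<Sigma> \<rho> e f ` degree_chains \<Sigma> \<rho> (Suc q)"

definition twisted_cohomology :: "'n::{finite,linorder} cone set \<Rightarrow>
    ('d::finite \<Rightarrow> 'n lattice) \<Rightarrow> ('n \<Rightarrow> 'n lattice \<Rightarrow> int) \<Rightarrow>
    'd X_section \<Rightarrow> nat \<Rightarrow>
    (nat \<Rightarrow> ('d, 'n) polyvector) set monoid"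
  where "twisted_cohomology \<Sigma> \<rho> e f q =
    (polyvector_series \<Sigma> \<rho>)\<lparr>carrier := degree_cycles \<Sigma> \<rho> e f q\<rparr> Mod degree_boundaries \<Sigma> \<rho> e f q"

definition superpotential :: "'n::finite cone set \<Rightarrow> ('d::finite \<Rightarrow> 'n lattice) \<Rightarrow>
    'd X_section"
  where "superpotential \<Sigma> \<rho> = X_restrict \<Sigma> \<rho> (\<lambda>z. \<Sum>i\<in>UNIV. z $ i)"

text \<open>The cohomology is concentrated in \<open>\<Theta>\<close>-degree \<open>0\<close>, so the Brieskorn lattice is its part of
  degree \<open>0\<close> (as an additive group, written multiplicatively).\<close>

definition brieskorn_lattice :: "'n::{finite,linorder} cone set \<Rightarrow>
    ('d::finite \<Rightarrow> 'n lattice) \<Rightarrow> ('n \<Rightarrow> 'n lattice \<Rightarrow> int) \<Rightarrow>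
    (nat \<Rightarrow> ('d, 'n) polyvector) set monoid"
  where "brieskorn_lattice \<Sigma> \<rho> e = twisted_cohomology \<Sigma> \<rho> e (superpotential \<Sigma> \<rho>) 0"

definition function_series :: "'n::{finite,linorder} cone set \<Rightarrow>
    ('d::finite \<Rightarrow> 'n lattice) \<Rightarrow> (complex ^ 'd \<Rightarrow> complex) \<Rightarrow> nat \<Rightarrow> ('d, 'n) polyvector"
  where "function_series \<Sigma> \<rho> h = (\<lambda>j S.
    if j = 0 \<and> S = {} then X_restrict \<Sigma> \<rho> h else \<zero>\<^bsub>X_functions \<Sigma> \<rho>\<^esub>)"

definition brieskorn_class :: "'n::{finite,linorder} cone set \<Rightarrow>
    ('d::finite \<Rightarrow> 'n lattice) \<Rightarrow> ('n \<Rightarrow> 'n lattice \<Rightarrow> int) \<Rightarrow> (complex ^ 'd \<Rightarrow> complex) \<Rightarrow>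
    (nat \<Rightarrow> ('d, 'n) polyvector) set"
  where "brieskorn_class \<Sigma> \<rho> e h = degree_boundaries \<Sigma> \<rho> e (superpotential \<Sigma> \<rho>) 0
    #>\<^bsub>polyvector_series \<Sigma> \<rho>\<^esub> function_series \<Sigma> \<rho> h"

definition generating_rays :: "('d \<Rightarrow> 'n::finite lattice) \<Rightarrow> 'n cone \<Rightarrow> 'd set"
  where "generating_rays \<rho> \<tau> = {i. cone_face (convex_cone hull {real_vec (\<rho> i)}) \<tau>}"

definition cone_monomial :: "('d::finite \<Rightarrow> 'n::finite lattice) \<Rightarrow> 'n cone \<Rightarrow>
    complex ^ 'd \<Rightarrow> complex"
  where "cone_monomial \<rho> \<tau> z = (\<Prod>i\<in>generating_rays \<rho> \<tau>. z $ i)"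

end

theory Submission
  imports Defs "HOL-Complex_Analysis.Cauchy_Integral_Formula"
begin

text \<open>Choose a ray \<open>\<rho>\<^sub>0\<close> of \<open>\<sigma>\<close> that is not a ray of \<open>\<gamma>\<^sub>1\<close>.  As \<open>\<gamma>\<^sub>2\<close> is smooth, some \<open>m \<in> M\<close> takes
  the value \<open>1\<close> on \<open>\<rho>\<^sub>0\<close> and \<open>0\<close> on all other rays of \<open>\<gamma>\<^sub>2\<close>.  Let \<open>\<tau>\<close> be the facet of \<open>\<sigma>\<close> opposite to
  \<open>\<rho>\<^sub>0\<close>.  The differential of \<open>P(\<tau>) \<theta>\<^sub>m\<close> is \<open>P(\<tau>) \<Sum>\<^sub>i \<langle>\<rho>\<^sub>i, m\<rangle> z\<^sub>i\<close>, because \<open>\<theta>\<^sub>m\<close> annihilates \<open>P(\<tau>)\<close>.  Hence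
  \<open>P(\<sigma>) = - \<Sum>\<^sub>i \<langle>\<rho>\<^sub>i, m\<rangle> z\<^sub>i P(\<tau>)\<close> in the Brieskorn lattice, the sum over the rays outside \<open>\<gamma>\<^sub>2\<close>; each
  \<open>z\<^sub>i P(\<tau>)\<close> is either zero on \<open>X\<close> or the monomial of a cone spanned by \<open>\<tau>\<close> and \<open>\<rho>\<^sub>i\<close>.\<close>

subsection \<open>Holomorphic functions of several variables\<close>

text \<open>Both conditions on the new cones come from the choice of the ray and of m: leaving out a
  ray that is not in \<gamma>1 keeps \<gamma>1 inside every cone spanned by \<tau> and a further
  ray, and making m vanish on the other rays of all of \<gamma>2, not just of \<sigma>, forces every
  remaining ray out of \<gamma>2. The relation must hold among power series in u; the u-term of the
  differential vanishes because a monomial is an eigenvector of a frame field, with eigenvalue the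
  sum of the values of m on its rays. So no correction of higher order in u arises. Being zero on X
  means lying in the Stanley-Reisner ideal of every stalk, which is formally more than vanishing at
  the points of X. As sections are families of cosets of germs, the frame fields must be shown to
  act on cosets: derivatives of holomorphic functions have to be holomorphic again, and the ideal
  has to be stable. The analytic part supplies this; the cones are then handled by integral linear
  algebra.\<close>

lemma slice_nth [simp]: "slice z i w $ j = (if j = i then w else z $ j)"
  by (simp add: slice_def)

lemma slice_self [simp]: "slice z i (z $ i) = z"
  by (simp add: slice_def vec_eq_iff)

lemma slice_slice [simp]: "slice (slice z i w) i w' = slice z i w'"
  by (simp add: vec_eq_iff)

lemma slice_eq_axis: "slice z i w = z + axis i (w - z $ i)"
  by (simp add: vec_eq_iff axis_def)

lemma norm_axis: "norm (axis i t :: complex ^ 'd::finite) = norm t"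
proof -
  have "norm (axis i t $ j) = (if j = i then norm t else 0)" for j
    by (simp add: axis_def)
  then show ?thesis
    by (simp add: norm_vec_def L2_set_def if_distrib[of "\<lambda>x. x\<^sup>2"] cong: if_cong)
qed

lemma slice_add: "slice z j w + v = slice (z + v) j (w + v $ j)"
  by (simp add: vec_eq_iff)

lemma continuous_on_slice [continuous_intros]:
  "continuous_on A f \<Longrightarrow> continuous_on A (\<lambda>w. slice z i (f w))"
  unfolding slice_def
proof (rule continuous_on_vec_lambda)
  fix j assume "continuous_on A f"
  then show "continuous_on A (\<lambda>w. if j = i then f w else z $ j)"
    by (cases "j = i") auto
qed

lemma open_slice_vimage: "open U \<Longrightarrow> open {w. slice z i w \<in> U}"
  using open_vimage[of U "slice z i"] continuous_on_slice[of UNIV "\<lambda>w. w" z i]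
  by (simp add: vimage_def)

text \<open>Bridge to the one-variable theory: on the parameters for which the coordinate line stays
  in \<open>U\<close>, Cauchy estimates and Weierstrass' theorem become available.\<close>

lemma holomorphic_several_slice:
  assumes "holomorphic_several h U"
  shows "(\<lambda>w. h (slice z i w)) holomorphic_on {w. slice z i w \<in> U}"
  unfolding holomorphic_on_def
proof safe
  fix w assume "slice z i w \<in> U"
  then have "(\<lambda>w'. h (slice (slice z i w) i w')) field_differentiable at (slice z i w $ i)"
    using assms unfolding holomorphic_several_def by blast
  then show "(\<lambda>w. h (slice z i w)) field_differentiable at w within {w. slice z i w \<in> U}"
    by (simp add: field_differentiable_at_within)
qed

lemma holomorphic_several_field_differentiable:
  "holomorphic_several h U \<Longrightarrow> z \<in> U \<Longrightarrow> (\<lambda>w. h (slice z i w)) field_differentiable at (z $ i)"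
  by (simp add: holomorphic_several_def)

lemma holomorphic_several_continuous: "holomorphic_several h U \<Longrightarrow> continuous_on U h"
  by (simp add: holomorphic_several_def)

section \<open>Closure of holomorphy under restriction and algebraic operations\<close>

lemma holomorphic_several_subset:
  "holomorphic_several h U \<Longrightarrow> V \<subseteq> U \<Longrightarrow> holomorphic_several h V"
  unfolding holomorphic_several_def by (meson continuous_on_subset subsetD)

lemma holomorphic_several_const: "holomorphic_several (\<lambda>z. c) U"
  by (simp add: holomorphic_several_def)

lemma holomorphic_several_coord: "holomorphic_several (\<lambda>z. z $ j) U"
  unfolding holomorphic_several_def
proof (intro conjI ballI allI)
  show "(\<lambda>w. slice z i w $ j) field_differentiable at (z $ i)" for z :: "complex ^ 'a" and i
    by (cases "j = i") auto
qed (intro continuous_on_component continuous_on_id)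

lemma holomorphic_several_add:
  "holomorphic_several g U \<Longrightarrow> holomorphic_several h U \<Longrightarrow> holomorphic_several (\<lambda>z. g z + h z) U"
  by (auto simp: holomorphic_several_def intro: continuous_on_add field_differentiable_add)

lemma holomorphic_several_mult:
  "holomorphic_several g U \<Longrightarrow> holomorphic_several h U \<Longrightarrow> holomorphic_several (\<lambda>z. g z * h z) U"
  by (auto simp: holomorphic_several_def intro: continuous_on_mult field_differentiable_mult)

lemma holomorphic_several_minus:
  "holomorphic_several h U \<Longrightarrow> holomorphic_several (\<lambda>z. - h z) U"
  by (auto simp: holomorphic_several_def intro: continuous_on_minus field_differentiable_minus)

lemma holomorphic_several_sum:
  "(\<And>i. i \<in> I \<Longrightarrow> holomorphic_several (h i) U) \<Longrightarrow> holomorphic_several (\<lambda>z. \<Sum>i\<in>I. h i z) U"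
  by (induction I rule: infinite_finite_induct)
    (auto intro: holomorphic_several_const holomorphic_several_add)

lemma holomorphic_several_prod:
  "(\<And>i. i \<in> I \<Longrightarrow> holomorphic_several (h i) U) \<Longrightarrow> holomorphic_several (\<lambda>z. \<Prod>i\<in>I. h i z) U"
  by (induction I rule: infinite_finite_induct)
    (auto intro: holomorphic_several_const holomorphic_several_mult)

lemmas holomorphic_several_intros =
  holomorphic_several_const holomorphic_several_coord holomorphic_several_add
  holomorphic_several_mult holomorphic_several_minus holomorphic_several_sum
  holomorphic_several_prod

section \<open>Locality and uniform limits\<close>

lemma eventually_slice_in:
  assumes "open U" "z \<in> U"
  shows "\<forall>\<^sub>F w in nhds (z $ i). slice z i w \<in> U"
  using eventually_nhds_in_open[OF open_slice_vimage[OF assms(1), of z i], of "z $ i"] assms(2)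
  by simp

lemma partial_deriv_cong:
  assumes "open U" "z \<in> U" "\<And>x. x \<in> U \<Longrightarrow> g x = h x"
  shows "partial_deriv i g z = partial_deriv i h z"
  unfolding partial_deriv_def
  by (rule deriv_cong_ev) (use eventually_slice_in[OF assms(1,2), of i] assms(3) in
      \<open>auto elim: eventually_mono\<close>)

text \<open>Openness of \<open>U\<close> matters: the derivatives are taken in a full neighbourhood
  on the coordinate line, and the total functions \<open>g\<close> and \<open>h\<close> are
  unrelated outside \<open>U\<close>.\<close>

lemma holomorphic_several_cong:
  assumes "open U" "holomorphic_several h U" "\<And>z. z \<in> U \<Longrightarrow> g z = h z"
  shows "holomorphic_several g U"
  unfolding holomorphic_several_def
proof (intro conjI ballI allI)
  show "continuous_on U g"
    using assms continuous_on_cong holomorphic_several_continuous by metis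
  fix z i assume z: "z \<in> U"
  have "\<forall>\<^sub>F w in nhds (z $ i). g (slice z i w) = h (slice z i w)"
    using eventually_slice_in[OF assms(1) z, of i] assms(3) by (auto elim: eventually_mono)
  moreover obtain D where "((\<lambda>w. h (slice z i w)) has_field_derivative D) (at (z $ i))"
    using holomorphic_several_field_differentiable[OF assms(2) z, of i]
    unfolding field_differentiable_def by blast
  ultimately show "(\<lambda>w. g (slice z i w)) field_differentiable at (z $ i)"
    using DERIV_cong_ev[of "z $ i" "z $ i" "\<lambda>w. g (slice z i w)" "\<lambda>w. h (slice z i w)" D D]
    unfolding field_differentiable_def by blast
qed

text \<open>Both defining conditions can be checked near each point. This is what allows the limit
  argument for derivatives, whose convergence is uniform only on small balls.\<close>

lemma holomorphic_several_local:
  assumes "\<And>p. p \<in> U \<Longrightarrow> \<exists>V. open V \<and> p \<in> V \<and> holomorphic_several h V"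
  shows "holomorphic_several h U"
  unfolding holomorphic_several_def
proof (intro conjI ballI allI)
  show "continuous_on U h"
    by (meson assms continuous_at_imp_continuous_on continuous_on_eq_continuous_at
        holomorphic_several_continuous)
  show "(\<lambda>w. h (slice z i w)) field_differentiable at (z $ i)" if "z \<in> U" for z i
    using assms[OF that] by (auto intro: holomorphic_several_field_differentiable)
qed

text \<open>Continuity of the limit is the uniform limit theorem; holomorphy in one variable is
  Weierstrass' theorem on a closed disc in the coordinate line through \<open>z\<close>.\<close>

lemma holomorphic_several_uniform_limit:
  assumes "open U" "\<forall>\<^sub>F n in F. holomorphic_several (g n) U" "uniform_limit U g h F"
    and F: "F \<noteq> bot"
  shows "holomorphic_several h U"
  unfolding holomorphic_several_def
proof (intro conjI ballI allI)
  show "continuous_on U h"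
    by (rule uniform_limit_theorem[OF _ assms(3)])
      (use assms(2) F in \<open>auto elim: eventually_mono intro: holomorphic_several_continuous\<close>)
  fix z i assume z: "z \<in> U"
  have "z $ i \<in> {w. slice z i w \<in> U}" using z by simp
  then obtain r where r: "r > 0" "cball (z $ i) r \<subseteq> {w. slice z i w \<in> U}"
    using open_slice_vimage[OF assms(1), of z i] open_contains_cball by blast
  have hol: "\<forall>\<^sub>F n in F. continuous_on (cball (z $ i) r) (\<lambda>w. g n (slice z i w)) \<and>
      (\<lambda>w. g n (slice z i w)) holomorphic_on ball (z $ i) r"
    using assms(2)
  proof eventually_elim
    case (elim n)
    then have "(\<lambda>w. g n (slice z i w)) holomorphic_on cball (z $ i) r"
      using holomorphic_several_slice holomorphic_on_subset r(2) by blast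
    then show ?case
      using ball_subset_cball holomorphic_on_imp_continuous_on holomorphic_on_subset by blast
  qed
  have "uniform_limit (cball (z $ i) r) (\<lambda>n w. g n (slice z i w)) (\<lambda>w. h (slice z i w)) F"
    by (rule uniform_limit_compose'[OF assms(3)]) (use r(2) in auto)
  then have "(\<lambda>w. h (slice z i w)) holomorphic_on ball (z $ i) r"
    using holomorphic_uniform_limit[OF hol] F by blast
  then show "(\<lambda>w. h (slice z i w)) field_differentiable at (z $ i)"
    using holomorphic_on_imp_differentiable_at[OF _ open_ball] r(1) by simp
qed

text \<open>Partial derivatives are locally uniform limits of difference quotients, with an error that
  the Cauchy estimate of the second derivative controls.\<close>

lemma difference_quotient_estimate:
  fixes \<phi> :: "complex \<Rightarrow> complex"
  assumes hol: "\<phi> holomorphic_on ball a (2 * r)"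
    and M: "\<And>w. w \<in> ball a (2 * r) \<Longrightarrow> norm (\<phi> w) \<le> M"
    and t: "norm t < r" "t \<noteq> 0"
  shows "norm ((\<phi> (a + t) - \<phi> a) / t - deriv \<phi> a) \<le> 2 * M / r\<^sup>2 * norm t"
proof -
  have r: "r > 0" using t by (smt (verit) norm_ge_zero)
  \<comment> \<open>The closed disc of radius \<open>r\<close> about any \<open>x\<close> in the
    smaller disc still lies in the disc of radius \<open>2 * r\<close>, so Cauchy's inequality gives
    one bound for all these \<open>x\<close>; the factor 2 is \<open>fact 2\<close>.\<close>
  have bound: "norm ((deriv ^^ 2) \<phi> x) \<le> 2 * M / r\<^sup>2" if x: "x \<in> ball a r" for x
  proof -
    have sub: "cball x r \<subseteq> ball a (2 * r)"
    proof
      fix y assume "y \<in> cball x r"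
      then show "y \<in> ball a (2 * r)"
        using x dist_triangle[of a y x] by (simp add: dist_commute)
    qed
    have "norm ((deriv ^^ 2) \<phi> x) \<le> fact 2 * M / r ^ 2"
    proof (rule Cauchy_inequality)
      show "\<phi> holomorphic_on ball x r"
        using hol sub ball_subset_cball holomorphic_on_subset by blast
      show "continuous_on (cball x r) \<phi>"
        using hol sub holomorphic_on_imp_continuous_on holomorphic_on_subset by blast
      show "norm (\<phi> y) \<le> M" if "norm (x - y) = r" for y
        using M[of y] sub that by (auto simp: dist_norm)
    qed fact
    then show ?thesis by simp
  qed
  have deriv: "((deriv ^^ i) \<phi> has_field_derivative (deriv ^^ Suc i) \<phi> x) (at x within ball a r)"
    if "x \<in> ball a r" for i x
    using holomorphic_derivI[OF holomorphic_higher_deriv[OF hol open_ball] open_ball, of x i]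
      that r by (auto intro: has_field_derivative_at_within)
  \<comment> \<open>First-order Taylor expansion: the error is quadratic in \<open>t\<close>, and
    dividing by \<open>t\<close> below leaves the linear factor of the claim.\<close>
  have "norm ((deriv ^^ 0) \<phi> (a + t) - (\<Sum>i\<le>1. (deriv ^^ i) \<phi> a * (a + t - a) ^ i / fact i))
      \<le> 2 * M / r\<^sup>2 * norm (a + t - a) ^ Suc 1 / fact 1"
    by (rule complex_Taylor[of "ball a r"])
      (use bound r t deriv in \<open>auto simp: numeral_2_eq_2 dist_norm\<close>)
  then have "norm (\<phi> (a + t) - \<phi> a - deriv \<phi> a * t) \<le> 2 * M / r\<^sup>2 * norm t * norm t"
    by (simp add: algebra_simps)
  moreover have "(\<phi> (a + t) - \<phi> a) / t - deriv \<phi> a = (\<phi> (a + t) - \<phi> a - deriv \<phi> a * t) / t"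
    using t by (simp add: field_simps)
  ultimately show ?thesis
    using t by (simp add: norm_divide pos_divide_le_eq)
qed

text \<open>Separate holomorphy of \<open>h\<close> does not directly show how
  \<open>partial_deriv i h\<close> depends on the other coordinates. The difference quotients are
  visibly continuous and separately holomorphic, and the uniform limit inherits both.\<close>

lemma holomorphic_several_partial_deriv:
  assumes U: "open U" and h: "holomorphic_several h U"
  shows "holomorphic_several (partial_deriv i h) U"
proof (rule holomorphic_several_local)
  fix p assume p: "p \<in> U"
  obtain r1 where r1: "r1 > 0" "ball p r1 \<subseteq> U"
    using U p open_contains_ball by blast
  have "isCont h p"
    using h U p continuous_on_eq_continuous_at holomorphic_several_continuous by blast
  then obtain r2 where r2: "r2 > 0" "\<And>z. dist z p < r2 \<Longrightarrow> dist (h z) (h p) < 1"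
    unfolding continuous_at_eps_delta by (metis zero_less_one)
  \<comment> \<open>Base points range over radius \<open>r\<close> and shifts along an axis over
    radius \<open>2 * r\<close>, so everything stays in the ball of radius \<open>3 * r\<close>,
    where \<open>h\<close> is holomorphic and bounded by \<open>M\<close>.\<close>
  define r where "r = min r1 r2 / 3"
  define M where "M = norm (h p) + 1"
  have r: "r > 0" using r1 r2 by (simp add: r_def)
  have sub: "ball p (3 * r) \<subseteq> U" using r1 by (auto simp: r_def)
  have M: "norm (h z) \<le> M" if "z \<in> ball p (3 * r)" for z
  proof -
    have "dist (h z) (h p) < 1"
      using that by (intro r2(2)) (auto simp: r_def dist_commute)
    then show ?thesis
      using norm_triangle_sub[of "h z" "h p"] by (simp add: M_def dist_norm)
  qed
  have near: "z + axis i t \<in> ball p (3 * r)" if "z \<in> ball p r" "norm t < 2 * r" for z t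
  proof -
    have "dist p (z + axis i t) \<le> dist p z + dist z (z + axis i t)"
      by (rule dist_triangle)
    also have "dist z (z + axis i t) = norm t"
      by (simp add: dist_norm norm_axis)
    finally show ?thesis using that by simp
  qed
  have est: "norm ((h (z + axis i t) - h z) / t - partial_deriv i h z) \<le> 2 * M / r\<^sup>2 * norm t"
    if z: "z \<in> ball p r" and t: "norm t < r" "t \<noteq> 0" for z t
  proof -
    have in3: "slice z i w \<in> ball p (3 * r)" if "w \<in> ball (z $ i) (2 * r)" for w
      using near[OF z, of "w - z $ i"] that
      by (simp add: slice_eq_axis dist_norm norm_minus_commute)
    have "norm ((h (slice z i (z $ i + t)) - h (slice z i (z $ i))) / t
        - deriv (\<lambda>w. h (slice z i w)) (z $ i)) \<le> 2 * M / r\<^sup>2 * norm t"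
    proof (rule difference_quotient_estimate[OF _ _ t])
      show "(\<lambda>w. h (slice z i w)) holomorphic_on ball (z $ i) (2 * r)"
        by (rule holomorphic_on_subset[OF holomorphic_several_slice[OF h]]) (use in3 sub in auto)
      show "norm (h (slice z i w)) \<le> M" if "w \<in> ball (z $ i) (2 * r)" for w
        using M in3 that by blast
    qed
    then show ?thesis
      by (simp add: partial_deriv_def slice_eq_axis[of z i "z $ i + t"])
  qed
  \<comment> \<open>A null sequence of nonzero increments; adding 2 makes the norm strictly smaller
    than \<open>r\<close> already for \<open>n = 0\<close>.\<close>
  define t :: "nat \<Rightarrow> complex" where "t n = of_real (r / (n + 2))" for n
  have t: "norm (t n) < r" "t n \<noteq> 0" for n
    using r by (auto simp: t_def norm_divide field_simps add_pos_nonneg simp flip: of_nat_Suc)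
  define g where "g n z = (h (z + axis i (t n)) - h z) * inverse (t n)" for n z
  have "holomorphic_several (partial_deriv i h) (ball p r)"
  proof (rule holomorphic_several_uniform_limit[OF open_ball])
    show "\<forall>\<^sub>F n in sequentially. holomorphic_several (g n) (ball p r)"
    proof (rule always_eventually, rule allI)
      fix n
      have inU: "z + axis i (t n) \<in> U" if "z \<in> ball p r" for z
        using near[OF that, of "t n"] t[of n] r sub by force
      have "holomorphic_several (\<lambda>z. h (z + axis i (t n))) (ball p r)"
        unfolding holomorphic_several_def
      proof (intro conjI ballI allI)
        show "continuous_on (ball p r) (\<lambda>z. h (z + axis i (t n)))"
        proof (rule continuous_on_compose2[OF holomorphic_several_continuous[OF h]])
          show "continuous_on (ball p r) (\<lambda>z. z + axis i (t n))"
            by (intro continuous_on_add continuous_on_id continuous_on_const)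
          show "(\<lambda>z. z + axis i (t n)) ` ball p r \<subseteq> U"
            using inU by blast
        qed
        fix z j assume z: "z \<in> ball p r"
        have "(\<lambda>w. h (slice (z + axis i (t n)) j w)) field_differentiable
            at ((z + axis i (t n)) $ j)"
          by (rule holomorphic_several_field_differentiable[OF h inU[OF z]])
        then have "(\<lambda>w. h (slice (z + axis i (t n)) j w)) field_differentiable
            at (z $ j + axis i (t n) $ j)"
          by simp
        then have "(\<lambda>w. h (slice (z + axis i (t n)) j w)) \<circ> (\<lambda>w. w + axis i (t n) $ j)
            field_differentiable at (z $ j)"
          by (intro field_differentiable_compose) (auto intro: derivative_intros)
        then show "(\<lambda>w. h (slice z j w + axis i (t n))) field_differentiable at (z $ j)"
          by (simp add: slice_add o_def)
      qed
      moreover have "holomorphic_several h (ball p r)"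
        by (rule holomorphic_several_subset[OF h]) (use sub r in \<open>auto simp: subset_iff\<close>)
      ultimately have "holomorphic_several
          (\<lambda>z. (h (z + axis i (t n)) + - h z) * inverse (t n)) (ball p r)"
        by (intro holomorphic_several_intros)
      then show "holomorphic_several (g n) (ball p r)"
        by (simp add: g_def[abs_def])
    qed
    have lim: "(\<lambda>n. 2 * M / r\<^sup>2 * norm (t n)) \<longlonglongrightarrow> 0"
    proof -
      have "(\<lambda>n. r / real (n + 2)) \<longlonglongrightarrow> 0"
        by (rule LIMSEQ_ignore_initial_segment[OF lim_const_over_n])
      then have "t \<longlonglongrightarrow> of_real 0"
        unfolding t_def by (intro tendsto_of_real) (simp add: add.commute)
      then have "(\<lambda>n. norm (t n)) \<longlonglongrightarrow> 0"
        by (simp add: tendsto_norm_zero)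
      then show ?thesis by (rule tendsto_mult_right_zero)
    qed
    show "uniform_limit (ball p r) g (partial_deriv i h) sequentially"
    proof (rule uniform_limitI)
      fix e :: real assume "e > 0"
      with lim have "\<forall>\<^sub>F n in sequentially. 2 * M / r\<^sup>2 * norm (t n) < e"
        by (rule order_tendstoD)
      then show "\<forall>\<^sub>F n in sequentially. \<forall>x\<in>ball p r. dist (g n x) (partial_deriv i h x) < e"
      proof eventually_elim
        case (elim n)
        then show ?case
          using est[OF _ t[of n]] by (fastforce simp: g_def dist_norm divide_inverse)
      qed
    qed
  qed auto
  then show "\<exists>V. open V \<and> p \<in> V \<and> holomorphic_several (partial_deriv i h) V"
    using r by (metis centre_in_ball open_ball)
qed

subsection \<open>The frame vector fields\<close>

context
  fixes U :: "(complex ^ 'd::finite) set"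
  assumes U: "open U"
begin

lemma log_field_cong:
  "z \<in> U \<Longrightarrow> (\<And>x. x \<in> U \<Longrightarrow> g x = h x) \<Longrightarrow> log_field \<rho> m g z = log_field \<rho> m h z"
  unfolding log_field_def using partial_deriv_cong[OF U, of z g h] by simp

lemma holomorphic_several_log_field:
  "holomorphic_several h U \<Longrightarrow> holomorphic_several (log_field \<rho> m h) U"
  unfolding log_field_def[abs_def]
  by (intro holomorphic_several_intros holomorphic_several_partial_deriv U)

lemma log_field_add:
  assumes "z \<in> U" "holomorphic_several g U" "holomorphic_several h U"
  shows "log_field \<rho> m (\<lambda>x. g x + h x) z = log_field \<rho> m g z + log_field \<rho> m h z"
proof -
  have "partial_deriv i (\<lambda>x. g x + h x) z = partial_deriv i g z + partial_deriv i h z" for i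
    unfolding partial_deriv_def
    by (rule deriv_add) (use assms in \<open>auto intro: holomorphic_several_field_differentiable\<close>)
  then show ?thesis by (simp add: log_field_def algebra_simps sum.distrib)
qed

lemma log_field_mult:
  assumes "z \<in> U" "holomorphic_several g U" "holomorphic_several h U"
  shows "log_field \<rho> m (\<lambda>x. g x * h x) z = g z * log_field \<rho> m h z + log_field \<rho> m g z * h z"
proof -
  have "partial_deriv i (\<lambda>x. g x * h x) z = g z * partial_deriv i h z + partial_deriv i g z * h z" for i
    unfolding partial_deriv_def
    by (subst deriv_mult) (use assms in \<open>auto intro: holomorphic_several_field_differentiable\<close>)
  then show ?thesis
    by (simp add: log_field_def algebra_simps sum.distrib sum_distrib_left sum_distrib_right)
qed

lemma log_field_const: "log_field \<rho> m (\<lambda>x. c) z = 0"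
  by (simp add: log_field_def partial_deriv_def)

lemma log_field_sum:
  assumes "z \<in> U" "\<And>i. i \<in> I \<Longrightarrow> holomorphic_several (h i) U"
  shows "log_field \<rho> m (\<lambda>x. \<Sum>i\<in>I. h i x) z = (\<Sum>i\<in>I. log_field \<rho> m (h i) z)"
  using assms(2)
  by (induction I rule: infinite_finite_induct)
    (auto simp: log_field_const log_field_add[OF assms(1)] holomorphic_several_sum)

end

lemma log_field_coord: "log_field \<rho> m (\<lambda>x. x $ j) z = of_int (m (\<rho> j)) * z $ j"
proof -
  have "partial_deriv i (\<lambda>x. x $ j) z = (if i = j then 1 else 0)" for i
    by (simp add: partial_deriv_def)
  then have "log_field \<rho> m (\<lambda>x. x $ j) z = (\<Sum>i\<in>UNIV. if i = j then of_int (m (\<rho> i)) * z $ i else 0)"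
    unfolding log_field_def by (intro sum.cong) auto
  then show ?thesis by simp
qed

text \<open>Coordinates are eigenfunctions of the derivation and eigenvalues add under products.
  Both the stability of the Stanley-Reisner ideal and the vanishing of the u-term in the key
  relation rest on this formula.\<close>

lemma log_field_coord_prod:
  "log_field \<rho> m (\<lambda>x. \<Prod>i\<in>I. x $ i) z = (\<Sum>i\<in>I. of_int (m (\<rho> i))) * (\<Prod>i\<in>I. z $ i)"
proof (induction I rule: infinite_finite_induct)
  case (insert i I)
  have "log_field \<rho> m (\<lambda>x. x $ i * (\<Prod>i\<in>I. x $ i)) z =
     z $ i * log_field \<rho> m (\<lambda>x. \<Prod>i\<in>I. x $ i) z + log_field \<rho> m (\<lambda>x. x $ i) z * (\<Prod>i\<in>I. z $ i)"
    by (rule log_field_mult[OF open_UNIV UNIV_I]) (intro holomorphic_several_intros)+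
  with insert show ?case by (simp add: log_field_coord algebra_simps)
qed (auto simp: log_field_const[OF open_UNIV])

subsection \<open>The ring of functions on the Stanley-Reisner space\<close>

lemma germ_ring_simps [simp]:
  "mult (germ_ring p) g h = (\<lambda>z. g z * h z)" "one (germ_ring p) = (\<lambda>z. 1)"
  "add (germ_ring p) g h = (\<lambda>z. g z + h z)" "zero (germ_ring p) = (\<lambda>z. 0)"
  by (simp_all add: germ_ring_def)

lemma germ_carrierI:
  "open U \<Longrightarrow> p \<in> U \<Longrightarrow> holomorphic_several h U \<Longrightarrow> h \<in> carrier (germ_ring p)"
  by (auto simp: germ_ring_def)

lemma germ_carrierE:
  assumes "h \<in> carrier (germ_ring p)"
  obtains U where "open U" "p \<in> U" "holomorphic_several h U"
  using assms by (auto simp: germ_ring_def)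

lemma germ_carrierE2:
  assumes "g \<in> carrier (germ_ring p)" "h \<in> carrier (germ_ring p)"
  obtains U where "open U" "p \<in> U" "holomorphic_several g U" "holomorphic_several h U"
proof -
  obtain U V where "open U" "p \<in> U" "holomorphic_several g U"
    "open V" "p \<in> V" "holomorphic_several h V"
    using assms by (meson germ_carrierE)
  then show ?thesis
    by (intro that[of "U \<inter> V"]) (auto intro: holomorphic_several_subset)
qed

lemma germ_carrier_add:
  "g \<in> carrier (germ_ring p) \<Longrightarrow> h \<in> carrier (germ_ring p) \<Longrightarrow>
    (\<lambda>z. g z + h z) \<in> carrier (germ_ring p)"
  by (erule germ_carrierE2, assumption) (rule germ_carrierI, auto intro: holomorphic_several_add)

lemma germ_carrier_mult:
  "g \<in> carrier (germ_ring p) \<Longrightarrow> h \<in> carrier (germ_ring p) \<Longrightarrow>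
    (\<lambda>z. g z * h z) \<in> carrier (germ_ring p)"
  by (erule germ_carrierE2, assumption) (rule germ_carrierI, auto intro: holomorphic_several_mult)

lemma germ_carrier_const: "(\<lambda>z. c) \<in> carrier (germ_ring p)"
  by (rule germ_carrierI[OF open_UNIV UNIV_I holomorphic_several_const])

lemma germ_carrier_minus:
  "h \<in> carrier (germ_ring p) \<Longrightarrow> (\<lambda>z. - h z) \<in> carrier (germ_ring p)"
  using germ_carrier_mult[OF germ_carrier_const[of "-1"], of h] by simp

lemma germ_carrier_log_field:
  "h \<in> carrier (germ_ring p) \<Longrightarrow> log_field \<rho> m h \<in> carrier (germ_ring p)"
  by (erule germ_carrierE) (rule germ_carrierI, auto intro: holomorphic_several_log_field)

lemmas germ_carrier_intros =
  germ_carrier_add germ_carrier_mult germ_carrier_const germ_carrier_minus germ_carrier_log_field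

lemma cring_germ_ring: "cring (germ_ring p)"
proof (rule cringI)
  show "abelian_group (germ_ring p)"
  proof (rule abelian_groupI)
    show "\<exists>g\<in>carrier (germ_ring p). g \<oplus>\<^bsub>germ_ring p\<^esub> h = \<zero>\<^bsub>germ_ring p\<^esub>"
      if "h \<in> carrier (germ_ring p)" for h
      by (rule bexI[OF _ germ_carrier_minus[OF that]]) simp
  qed (auto intro: germ_carrier_intros simp: algebra_simps)
  show "Group.comm_monoid (germ_ring p)"
    by (rule Group.comm_monoidI) (auto intro: germ_carrier_intros simp: algebra_simps)
qed (auto simp: algebra_simps)

lemma a_inv_germ_ring:
  assumes "h \<in> carrier (germ_ring p)"
  shows "\<ominus>\<^bsub>germ_ring p\<^esub> h = (\<lambda>z. - h z)"
proof -
  interpret cring "germ_ring p" by (rule cring_germ_ring)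
  show ?thesis
    by (rule minus_equality) (use assms in \<open>auto intro: germ_carrier_minus\<close>)
qed

section \<open>The Stanley-Reisner ideal in the ring of germs\<close>

context
  fixes \<Sigma> :: "'n::finite cone set" and \<rho> :: "'d::finite \<Rightarrow> 'n lattice"
begin

lemma SR_idealI:
  assumes "open U" "p \<in> U" "\<And>I. I \<in> SR_nonfaces \<Sigma> \<rho> \<Longrightarrow> holomorphic_several (h I) U"
    "\<And>z. z \<in> U \<Longrightarrow> g z = (\<Sum>I\<in>SR_nonfaces \<Sigma> \<rho>. h I z * (\<Prod>i\<in>I. z $ i))"
  shows "g \<in> SR_ideal \<Sigma> \<rho> p"
  using assms unfolding SR_ideal_def by blast

lemma SR_idealE:
  assumes "g \<in> SR_ideal \<Sigma> \<rho> p"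
  obtains U h where "open U" "p \<in> U"
    "\<And>I. I \<in> SR_nonfaces \<Sigma> \<rho> \<Longrightarrow> holomorphic_several (h I) U"
    "\<And>z. z \<in> U \<Longrightarrow> g z = (\<Sum>I\<in>SR_nonfaces \<Sigma> \<rho>. h I z * (\<Prod>i\<in>I. z $ i))"
  using assms unfolding SR_ideal_def by blast

lemma SR_ideal_zero: "(\<lambda>z. 0) \<in> SR_ideal \<Sigma> \<rho> p"
  by (rule SR_idealI[of UNIV _ "\<lambda>I z. 0"]) (auto intro: holomorphic_several_const)

lemma SR_ideal_add:
  assumes "g \<in> SR_ideal \<Sigma> \<rho> p" "h \<in> SR_ideal \<Sigma> \<rho> p"
  shows "(\<lambda>z. g z + h z) \<in> SR_ideal \<Sigma> \<rho> p"
proof -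
  from assms(1) obtain U g' where U: "open U" "p \<in> U"
    "\<And>I. I \<in> SR_nonfaces \<Sigma> \<rho> \<Longrightarrow> holomorphic_several (g' I) U"
    "\<And>z. z \<in> U \<Longrightarrow> g z = (\<Sum>I\<in>SR_nonfaces \<Sigma> \<rho>. g' I z * (\<Prod>i\<in>I. z $ i))"
    by (rule SR_idealE) blast
  from assms(2) obtain V h' where V: "open V" "p \<in> V"
    "\<And>I. I \<in> SR_nonfaces \<Sigma> \<rho> \<Longrightarrow> holomorphic_several (h' I) V"
    "\<And>z. z \<in> V \<Longrightarrow> h z = (\<Sum>I\<in>SR_nonfaces \<Sigma> \<rho>. h' I z * (\<Prod>i\<in>I. z $ i))"
    by (rule SR_idealE) blast
  show ?thesis
  proof (rule SR_idealI)
    show "open (U \<inter> V)" "p \<in> U \<inter> V" using U V by auto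
    show "holomorphic_several (\<lambda>z. g' I z + h' I z) (U \<inter> V)" if "I \<in> SR_nonfaces \<Sigma> \<rho>" for I
      using U(3)[OF that] V(3)[OF that]
      by (auto intro!: holomorphic_several_add elim: holomorphic_several_subset)
    show "g z + h z = (\<Sum>I\<in>SR_nonfaces \<Sigma> \<rho>. (g' I z + h' I z) * (\<Prod>i\<in>I. z $ i))"
      if "z \<in> U \<inter> V" for z
      using U(4)[of z] V(4)[of z] that by (simp add: distrib_right sum.distrib)
  qed
qed

lemma SR_ideal_mult:
  assumes "a \<in> carrier (germ_ring p)" "g \<in> SR_ideal \<Sigma> \<rho> p"
  shows "(\<lambda>z. a z * g z) \<in> SR_ideal \<Sigma> \<rho> p"
proof -
  from assms(2) obtain U g' where U: "open U" "p \<in> U"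
    "\<And>I. I \<in> SR_nonfaces \<Sigma> \<rho> \<Longrightarrow> holomorphic_several (g' I) U"
    "\<And>z. z \<in> U \<Longrightarrow> g z = (\<Sum>I\<in>SR_nonfaces \<Sigma> \<rho>. g' I z * (\<Prod>i\<in>I. z $ i))"
    by (rule SR_idealE) blast
  from assms(1) obtain V where V: "open V" "p \<in> V" "holomorphic_several a V"
    by (rule germ_carrierE)
  show ?thesis
  proof (rule SR_idealI)
    show "open (U \<inter> V)" "p \<in> U \<inter> V" using U V by auto
    show "holomorphic_several (\<lambda>z. a z * g' I z) (U \<inter> V)" if "I \<in> SR_nonfaces \<Sigma> \<rho>" for I
      using U(3)[OF that] V(3)
      by (auto intro!: holomorphic_several_mult elim: holomorphic_several_subset)
    show "a z * g z = (\<Sum>I\<in>SR_nonfaces \<Sigma> \<rho>. (a z * g' I z) * (\<Prod>i\<in>I. z $ i))"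
      if "z \<in> U \<inter> V" for z
      using U(4)[of z] that by (simp add: sum_distrib_left mult.assoc)
  qed
qed

lemma SR_ideal_minus: "g \<in> SR_ideal \<Sigma> \<rho> p \<Longrightarrow> (\<lambda>z. - g z) \<in> SR_ideal \<Sigma> \<rho> p"
  using SR_ideal_mult[OF germ_carrier_const[of "-1"]] by simp

lemma SR_ideal_sum:
  "(\<And>i. i \<in> I \<Longrightarrow> g i \<in> SR_ideal \<Sigma> \<rho> p) \<Longrightarrow> (\<lambda>z. \<Sum>i\<in>I. g i z) \<in> SR_ideal \<Sigma> \<rho> p"
  by (induction I rule: infinite_finite_induct) (auto intro: SR_ideal_zero SR_ideal_add)

lemma SR_ideal_nonface:
  assumes "J \<in> SR_nonfaces \<Sigma> \<rho>"
  shows "(\<lambda>z. \<Prod>i\<in>J. z $ i) \<in> SR_ideal \<Sigma> \<rho> p"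
proof (rule SR_idealI[of UNIV _ "\<lambda>I z. if I = J then 1 else 0"])
  fix z :: "complex ^ 'd"
  have "(\<Sum>I\<in>SR_nonfaces \<Sigma> \<rho>. (if I = J then 1 else 0) * (\<Prod>i\<in>I. z $ i)) =
      (\<Sum>I\<in>SR_nonfaces \<Sigma> \<rho>. if I = J then \<Prod>i\<in>I. z $ i else 0)"
    by (rule sum.cong) auto
  also have "\<dots> = (\<Prod>i\<in>J. z $ i)" using assms by simp
  finally show "(\<Prod>i\<in>J. z $ i) =
      (\<Sum>I\<in>SR_nonfaces \<Sigma> \<rho>. (if I = J then 1 else 0) * (\<Prod>i\<in>I. z $ i))" ..
qed (auto intro: holomorphic_several_const)

text \<open>Membership prescribes \<open>g\<close> only on a neighbourhood of \<open>p\<close>;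
  there it is a combination of holomorphic functions, which is all that the carrier demands.\<close>

lemma SR_ideal_subset_carrier: "SR_ideal \<Sigma> \<rho> p \<subseteq> carrier (germ_ring p)"
proof
  fix g assume "g \<in> SR_ideal \<Sigma> \<rho> p"
  then obtain U g' where U: "open U" "p \<in> U"
    "\<And>I. I \<in> SR_nonfaces \<Sigma> \<rho> \<Longrightarrow> holomorphic_several (g' I) U"
    "\<And>z. z \<in> U \<Longrightarrow> g z = (\<Sum>I\<in>SR_nonfaces \<Sigma> \<rho>. g' I z * (\<Prod>i\<in>I. z $ i))"
    by (rule SR_idealE) blast
  have "holomorphic_several (\<lambda>z. \<Sum>I\<in>SR_nonfaces \<Sigma> \<rho>. g' I z * (\<Prod>i\<in>I. z $ i)) U"
    by (intro holomorphic_several_intros U(3))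
  then have "holomorphic_several g U"
    using U(1,4) holomorphic_several_cong by blast
  with U show "g \<in> carrier (germ_ring p)" by (blast intro: germ_carrierI)
qed

lemma ideal_SR_ideal: "ideal (SR_ideal \<Sigma> \<rho> p) (germ_ring p)"
proof -
  interpret cring "germ_ring p" by (rule cring_germ_ring)
  show ?thesis
  proof (rule idealI)
    show "subgroup (SR_ideal \<Sigma> \<rho> p) (add_monoid (germ_ring p))"
    proof (rule subgroup.intro)
      show "inv\<^bsub>add_monoid (germ_ring p)\<^esub> g \<in> SR_ideal \<Sigma> \<rho> p" if "g \<in> SR_ideal \<Sigma> \<rho> p" for g
        using SR_ideal_minus[OF that] a_inv_germ_ring[of g p] that SR_ideal_subset_carrier[of p]
        by (auto simp: a_inv_def)
    qed (use SR_ideal_subset_carrier[of p] in \<open>auto intro: SR_ideal_add SR_ideal_zero\<close>)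
    show "a \<otimes>\<^bsub>germ_ring p\<^esub> x \<in> SR_ideal \<Sigma> \<rho> p"
      if "a \<in> SR_ideal \<Sigma> \<rho> p" "x \<in> carrier (germ_ring p)" for a x
      using SR_ideal_mult[OF that(2,1)] by (simp add: mult.commute)
  qed (auto intro: SR_ideal_mult ring_axioms)
qed

text \<open>By the product rule, differentiating a coefficient times a generator gives a multiple of
  the same generator, since the generator is an eigenvector. The new coefficient is the derivative
  of the old one plus the eigenvalue times the old one.\<close>

lemma log_field_SR_ideal:
  assumes "g \<in> SR_ideal \<Sigma> \<rho> p"
  shows "log_field \<rho> m g \<in> SR_ideal \<Sigma> \<rho> p"
proof -
  from assms obtain U g' where U: "open U" "p \<in> U"
    "\<And>I. I \<in> SR_nonfaces \<Sigma> \<rho> \<Longrightarrow> holomorphic_several (g' I) U"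
    "\<And>z. z \<in> U \<Longrightarrow> g z = (\<Sum>I\<in>SR_nonfaces \<Sigma> \<rho>. g' I z * (\<Prod>i\<in>I. z $ i))"
    by (rule SR_idealE) blast
  show ?thesis
  proof (rule SR_idealI[OF U(1,2)])
    show "holomorphic_several (\<lambda>z. log_field \<rho> m (g' I) z + (\<Sum>i\<in>I. of_int (m (\<rho> i))) * g' I z) U"
      if "I \<in> SR_nonfaces \<Sigma> \<rho>" for I
      by (intro holomorphic_several_intros holomorphic_several_log_field U(1,3) that)
    fix z assume z: "z \<in> U"
    have "log_field \<rho> m g z =
        log_field \<rho> m (\<lambda>z. \<Sum>I\<in>SR_nonfaces \<Sigma> \<rho>. g' I z * (\<Prod>i\<in>I. z $ i)) z"
      by (rule log_field_cong[OF U(1) z U(4)])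
    also have "\<dots> = (\<Sum>I\<in>SR_nonfaces \<Sigma> \<rho>. log_field \<rho> m (\<lambda>z. g' I z * (\<Prod>i\<in>I. z $ i)) z)"
      by (intro log_field_sum[OF U(1) z] holomorphic_several_intros U(3))
    also have "\<dots> = (\<Sum>I\<in>SR_nonfaces \<Sigma> \<rho>.
        (log_field \<rho> m (g' I) z + (\<Sum>i\<in>I. of_int (m (\<rho> i))) * g' I z) * (\<Prod>i\<in>I. z $ i))"
    proof (rule sum.cong[OF refl])
      fix I assume I: "I \<in> SR_nonfaces \<Sigma> \<rho>"
      have "log_field \<rho> m (\<lambda>z. g' I z * (\<Prod>i\<in>I. z $ i)) z =
         g' I z * log_field \<rho> m (\<lambda>z. \<Prod>i\<in>I. z $ i) z + log_field \<rho> m (g' I) z * (\<Prod>i\<in>I. z $ i)"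
        by (intro log_field_mult[OF U(1) z] holomorphic_several_intros U(3) I)
      then show "log_field \<rho> m (\<lambda>z. g' I z * (\<Prod>i\<in>I. z $ i)) z =
        (log_field \<rho> m (g' I) z + (\<Sum>i\<in>I. of_int (m (\<rho> i))) * g' I z) * (\<Prod>i\<in>I. z $ i)"
        by (simp add: log_field_coord_prod algebra_simps)
    qed
    finally show "log_field \<rho> m g z = (\<Sum>I\<in>SR_nonfaces \<Sigma> \<rho>.
        (log_field \<rho> m (g' I) z + (\<Sum>i\<in>I. of_int (m (\<rho> i))) * g' I z) * (\<Prod>i\<in>I. z $ i))" .
  qed
qed

section \<open>Cosets of the ideal as germs of functions on X\<close>

lemma mem_X_germ_iff: "g \<in> X_germ \<Sigma> \<rho> p h \<longleftrightarrow> (\<lambda>z. g z - h z) \<in> SR_ideal \<Sigma> \<rho> p"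
proof
  assume "(\<lambda>z. g z - h z) \<in> SR_ideal \<Sigma> \<rho> p"
  then show "g \<in> X_germ \<Sigma> \<rho> p h"
    unfolding X_germ_def a_r_coset_def r_coset_def
    by (auto intro!: bexI[where x = "\<lambda>z. g z - h z"] simp: germ_ring_def)
qed (auto simp: X_germ_def a_r_coset_def r_coset_def germ_ring_def)

text \<open>No holomorphy of \<open>g\<close> or \<open>h\<close> is required: a coset is described
  by differences alone, so closure of the ideal under sums and negatives suffices.\<close>

lemma X_germ_eqI:
  assumes "(\<lambda>z. g z - h z) \<in> SR_ideal \<Sigma> \<rho> p"
  shows "X_germ \<Sigma> \<rho> p g = X_germ \<Sigma> \<rho> p h"
proof (rule Set.set_eqI)
  fix f
  show "f \<in> X_germ \<Sigma> \<rho> p g \<longleftrightarrow> f \<in> X_germ \<Sigma> \<rho> p h"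
    using SR_ideal_add[OF _ assms, of "\<lambda>z. f z - g z"]
      SR_ideal_add[OF _ SR_ideal_minus[OF assms], of "\<lambda>z. f z - h z"]
    by (auto simp: mem_X_germ_iff)
qed

lemma X_germ_self: "h \<in> X_germ \<Sigma> \<rho> p h"
  by (simp add: mem_X_germ_iff SR_ideal_zero)

lemma cring_X_stalk: "cring (X_stalk \<Sigma> \<rho> p)"
  unfolding X_stalk_def by (rule ideal.quotient_is_cring[OF ideal_SR_ideal cring_germ_ring])

lemma ring_hom_X_germ: "X_germ \<Sigma> \<rho> p \<in> ring_hom (germ_ring p) (X_stalk \<Sigma> \<rho> p)"
  using ideal.rcos_ring_hom[OF ideal_SR_ideal, of p] by (simp add: X_stalk_def X_germ_def[abs_def])

lemma X_germ_closed: "h \<in> carrier (germ_ring p) \<Longrightarrow> X_germ \<Sigma> \<rho> p h \<in> carrier (X_stalk \<Sigma> \<rho> p)"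
  by (rule ring_hom_closed[OF ring_hom_X_germ])

lemma X_germ_add:
  "g \<in> carrier (germ_ring p) \<Longrightarrow> h \<in> carrier (germ_ring p) \<Longrightarrow>
    X_germ \<Sigma> \<rho> p g \<oplus>\<^bsub>X_stalk \<Sigma> \<rho> p\<^esub> X_germ \<Sigma> \<rho> p h = X_germ \<Sigma> \<rho> p (\<lambda>z. g z + h z)"
  using ring_hom_add[OF ring_hom_X_germ, of g p h] by simp

lemma X_germ_mult:
  "g \<in> carrier (germ_ring p) \<Longrightarrow> h \<in> carrier (germ_ring p) \<Longrightarrow>
    X_germ \<Sigma> \<rho> p g \<otimes>\<^bsub>X_stalk \<Sigma> \<rho> p\<^esub> X_germ \<Sigma> \<rho> p h = X_germ \<Sigma> \<rho> p (\<lambda>z. g z * h z)"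
  using ring_hom_mult[OF ring_hom_X_germ, of g p h] by simp

lemma X_germ_one: "\<one>\<^bsub>X_stalk \<Sigma> \<rho> p\<^esub> = X_germ \<Sigma> \<rho> p (\<lambda>z. 1)"
  using ring_hom_one[OF ring_hom_X_germ, of p] by simp

lemma X_germ_zero: "\<zero>\<^bsub>X_stalk \<Sigma> \<rho> p\<^esub> = X_germ \<Sigma> \<rho> p (\<lambda>z. 0)"
  using ring_hom_zero[OF ring_hom_X_germ, of p] cring_germ_ring[of p] cring_X_stalk[of p]
  by (simp add: cring_def)

text \<open>Two representatives differ by an element of the ideal, which the field maps into the
  ideal. Linearity holds only where both functions are holomorphic, so the difference is compared on
  a common neighbourhood.\<close>

lemma X_germ_cong_log_field:
  assumes "h \<in> carrier (germ_ring p)" "g \<in> X_germ \<Sigma> \<rho> p h"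
  shows "X_germ \<Sigma> \<rho> p (log_field \<rho> m g) = X_germ \<Sigma> \<rho> p (log_field \<rho> m h)"
proof (rule X_germ_eqI)
  let ?d = "\<lambda>z. g z - h z"
  have d: "?d \<in> SR_ideal \<Sigma> \<rho> p" using assms(2) by (simp add: mem_X_germ_iff)
  then have "?d \<in> carrier (germ_ring p)" using SR_ideal_subset_carrier by blast
  with assms(1) obtain U where U: "open U" "p \<in> U" "holomorphic_several h U" "holomorphic_several ?d U"
    by (rule germ_carrierE2)
  have eq: "log_field \<rho> m g z - log_field \<rho> m h z = log_field \<rho> m ?d z" if "z \<in> U" for z
    using log_field_add[OF U(1) that U(3,4), of \<rho> m] by simp
  from log_field_SR_ideal[OF d, of m] obtain V f where V: "open V" "p \<in> V"
    "\<And>I. I \<in> SR_nonfaces \<Sigma> \<rho> \<Longrightarrow> holomorphic_several (f I) V"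
    "\<And>z. z \<in> V \<Longrightarrow> log_field \<rho> m ?d z = (\<Sum>I\<in>SR_nonfaces \<Sigma> \<rho>. f I z * (\<Prod>i\<in>I. z $ i))"
    by (rule SR_idealE) blast
  show "(\<lambda>z. log_field \<rho> m g z - log_field \<rho> m h z) \<in> SR_ideal \<Sigma> \<rho> p"
  proof (rule SR_idealI)
    show "open (U \<inter> V)" "p \<in> U \<inter> V" using U V by auto
    show "holomorphic_several (f I) (U \<inter> V)" if "I \<in> SR_nonfaces \<Sigma> \<rho>" for I
      using V(3)[OF that] by (rule holomorphic_several_subset) simp
  qed (use eq V(4) in auto)
qed

section \<open>Global sections and their ring structure\<close>

private abbreviation (input) "X \<equiv> X_space \<Sigma> \<rho>"
private abbreviation (input) "R \<equiv> X_functions \<Sigma> \<rho>"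

lemma X_functions_simps:
  "p \<in> X \<Longrightarrow> (s \<otimes>\<^bsub>R\<^esub> t) p = s p \<otimes>\<^bsub>X_stalk \<Sigma> \<rho> p\<^esub> t p"
  "p \<in> X \<Longrightarrow> (s \<oplus>\<^bsub>R\<^esub> t) p = s p \<oplus>\<^bsub>X_stalk \<Sigma> \<rho> p\<^esub> t p"
  "p \<in> X \<Longrightarrow> \<one>\<^bsub>R\<^esub> p = \<one>\<^bsub>X_stalk \<Sigma> \<rho> p\<^esub>"
  "p \<in> X \<Longrightarrow> \<zero>\<^bsub>R\<^esub> p = \<zero>\<^bsub>X_stalk \<Sigma> \<rho> p\<^esub>"
  by (simp_all add: X_functions_def)

lemma X_functions_extensional:
  "s \<otimes>\<^bsub>R\<^esub> t \<in> extensional X" "s \<oplus>\<^bsub>R\<^esub> t \<in> extensional X"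
  "\<one>\<^bsub>R\<^esub> \<in> extensional X" "\<zero>\<^bsub>R\<^esub> \<in> extensional X"
  "s \<in> carrier R \<Longrightarrow> s \<in> extensional X"
  by (simp_all add: X_functions_def)

lemma X_functions_carrierI:
  assumes "s \<in> extensional X"
    "\<And>p. p \<in> X \<Longrightarrow> \<exists>U h. open U \<and> p \<in> U \<and> holomorphic_several h U \<and>
      (\<forall>q\<in>U \<inter> X. s q = X_germ \<Sigma> \<rho> q h)"
  shows "s \<in> carrier R"
  using assms by (simp add: X_functions_def)

text \<open>One holomorphic function represents the section at all nearby points of X. Bundling its
  membership in each ring of germs makes the stalkwise rules applicable at every such point.\<close>

lemma X_functions_rep:
  assumes "s \<in> carrier R" "p \<in> X"
  obtains U h where "open U" "p \<in> U" "holomorphic_several h U"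
    "\<And>q. q \<in> U \<Longrightarrow> q \<in> X \<Longrightarrow> h \<in> carrier (germ_ring q) \<and> s q = X_germ \<Sigma> \<rho> q h"
proof -
  obtain U h where "open U" "p \<in> U" "holomorphic_several h U" "\<forall>q\<in>U \<inter> X. s q = X_germ \<Sigma> \<rho> q h"
    using assms by (auto simp: X_functions_def)
  then show ?thesis using that[of U h] by (auto intro: germ_carrierI)
qed

lemma X_functions_rep2:
  assumes "s \<in> carrier R" "t \<in> carrier R" "p \<in> X"
  obtains U g h where "open U" "p \<in> U" "holomorphic_several g U" "holomorphic_several h U"
    "\<And>q. q \<in> U \<Longrightarrow> q \<in> X \<Longrightarrow> g \<in> carrier (germ_ring q) \<and> h \<in> carrier (germ_ring q) \<and>
      s q = X_germ \<Sigma> \<rho> q g \<and> t q = X_germ \<Sigma> \<rho> q h"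
proof -
  obtain U g where U: "open U" "p \<in> U" "holomorphic_several g U"
    "\<And>q. q \<in> U \<Longrightarrow> q \<in> X \<Longrightarrow> g \<in> carrier (germ_ring q) \<and> s q = X_germ \<Sigma> \<rho> q g"
    using X_functions_rep[OF assms(1,3)] by metis
  obtain V h where V: "open V" "p \<in> V" "holomorphic_several h V"
    "\<And>q. q \<in> V \<Longrightarrow> q \<in> X \<Longrightarrow> h \<in> carrier (germ_ring q) \<and> t q = X_germ \<Sigma> \<rho> q h"
    using X_functions_rep[OF assms(2,3)] by metis
  show ?thesis
  proof (rule that)
    show "open (U \<inter> V)" "p \<in> U \<inter> V" using U V by auto
    show "holomorphic_several g (U \<inter> V)" "holomorphic_several h (U \<inter> V)"
      using U(3) V(3) by (auto elim: holomorphic_several_subset)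
  qed (use U(4) V(4) in auto)
qed

lemma X_functions_stalk:
  assumes "s \<in> carrier R" "p \<in> X"
  shows "s p \<in> carrier (X_stalk \<Sigma> \<rho> p)"
proof -
  from assms obtain U h where "p \<in> U"
    "\<And>q. q \<in> U \<Longrightarrow> q \<in> X \<Longrightarrow> h \<in> carrier (germ_ring q) \<and> s q = X_germ \<Sigma> \<rho> q h"
    by (rule X_functions_rep) blast
  with assms(2) show ?thesis by (simp add: X_germ_closed)
qed

lemma X_functions_eqI:
  assumes "s \<in> extensional X" "t \<in> extensional X" "\<And>p. p \<in> X \<Longrightarrow> s p = t p"
  shows "s = t"
  using assms by (rule extensionalityI)

lemma X_functions_mult_closed:
  assumes "s \<in> carrier R" "t \<in> carrier R"
  shows "s \<otimes>\<^bsub>R\<^esub> t \<in> carrier R"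
proof (rule X_functions_carrierI[OF X_functions_extensional(1)])
  fix p assume "p \<in> X"
  with assms obtain U g h where "open U" "p \<in> U" "holomorphic_several g U" "holomorphic_several h U"
    "\<And>q. q \<in> U \<Longrightarrow> q \<in> X \<Longrightarrow> g \<in> carrier (germ_ring q) \<and> h \<in> carrier (germ_ring q) \<and>
      s q = X_germ \<Sigma> \<rho> q g \<and> t q = X_germ \<Sigma> \<rho> q h"
    by (rule X_functions_rep2) blast
  then show "\<exists>U h. open U \<and> p \<in> U \<and> holomorphic_several h U \<and>
      (\<forall>q\<in>U \<inter> X. (s \<otimes>\<^bsub>R\<^esub> t) q = X_germ \<Sigma> \<rho> q h)"
    by (intro exI[of _ U] exI[of _ "\<lambda>z. g z * h z"])
      (auto simp: X_functions_simps X_germ_mult intro: holomorphic_several_mult)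
qed

lemma X_functions_add_closed:
  assumes "s \<in> carrier R" "t \<in> carrier R"
  shows "s \<oplus>\<^bsub>R\<^esub> t \<in> carrier R"
proof (rule X_functions_carrierI[OF X_functions_extensional(2)])
  fix p assume "p \<in> X"
  with assms obtain U g h where "open U" "p \<in> U" "holomorphic_several g U" "holomorphic_several h U"
    "\<And>q. q \<in> U \<Longrightarrow> q \<in> X \<Longrightarrow> g \<in> carrier (germ_ring q) \<and> h \<in> carrier (germ_ring q) \<and>
      s q = X_germ \<Sigma> \<rho> q g \<and> t q = X_germ \<Sigma> \<rho> q h"
    by (rule X_functions_rep2) blast
  then show "\<exists>U h. open U \<and> p \<in> U \<and> holomorphic_several h U \<and>
      (\<forall>q\<in>U \<inter> X. (s \<oplus>\<^bsub>R\<^esub> t) q = X_germ \<Sigma> \<rho> q h)"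
    by (intro exI[of _ U] exI[of _ "\<lambda>z. g z + h z"])
      (auto simp: X_functions_simps X_germ_add intro: holomorphic_several_add)
qed

lemma X_restrict_closed:
  assumes "holomorphic_several h UNIV"
  shows "X_restrict \<Sigma> \<rho> h \<in> carrier R"
  by (rule X_functions_carrierI)
    (use assms in \<open>auto simp: X_restrict_def intro!: exI[of _ UNIV] exI[of _ h]\<close>)

lemma X_restrict_one: "\<one>\<^bsub>R\<^esub> = X_restrict \<Sigma> \<rho> (\<lambda>z. 1)"
  by (simp add: X_functions_def X_restrict_def X_germ_one cong: restrict_cong)

lemma X_restrict_zero: "\<zero>\<^bsub>R\<^esub> = X_restrict \<Sigma> \<rho> (\<lambda>z. 0)"
  by (simp add: X_functions_def X_restrict_def X_germ_zero cong: restrict_cong)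

lemma X_restrict_add:
  "holomorphic_several g UNIV \<Longrightarrow> holomorphic_several h UNIV \<Longrightarrow>
    X_restrict \<Sigma> \<rho> g \<oplus>\<^bsub>R\<^esub> X_restrict \<Sigma> \<rho> h = X_restrict \<Sigma> \<rho> (\<lambda>z. g z + h z)"
  by (auto simp: X_functions_def X_restrict_def X_germ_add germ_carrierI[OF open_UNIV UNIV_I]
      cong: restrict_cong)

lemma X_restrict_mult:
  "holomorphic_several g UNIV \<Longrightarrow> holomorphic_several h UNIV \<Longrightarrow>
    X_restrict \<Sigma> \<rho> g \<otimes>\<^bsub>R\<^esub> X_restrict \<Sigma> \<rho> h = X_restrict \<Sigma> \<rho> (\<lambda>z. g z * h z)"
  by (auto simp: X_functions_def X_restrict_def X_germ_mult germ_carrierI[OF open_UNIV UNIV_I]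
      cong: restrict_cong)

text \<open>The axioms hold in each stalk, and sections are extensional, so equality at the points
  of X is equality. The list \<open>ext\<close> has one entry for each pair of shapes that the two
  sides of an axiom can take.\<close>

lemma cring_X_functions: "cring R"
proof (rule cringI)
  note [simp] = X_functions_simps
  note ext = X_functions_eqI[OF X_functions_extensional(1) X_functions_extensional(1)]
    X_functions_eqI[OF X_functions_extensional(2) X_functions_extensional(2)]
    X_functions_eqI[OF X_functions_extensional(1) X_functions_extensional(2)]
    X_functions_eqI[OF X_functions_extensional(1) X_functions_extensional(5)]
    X_functions_eqI[OF X_functions_extensional(2) X_functions_extensional(5)]
    X_functions_eqI[OF X_functions_extensional(2) X_functions_extensional(4)]
  have ring: "ring (X_stalk \<Sigma> \<rho> p)" "abelian_monoid (X_stalk \<Sigma> \<rho> p)"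
    "Group.comm_monoid (X_stalk \<Sigma> \<rho> p)" "Group.monoid (X_stalk \<Sigma> \<rho> p)" for p
    using cring_X_stalk[of p]
    by (auto simp: cring_def ring_def abelian_group_def Group.comm_monoid_def)
  show "abelian_group R"
  proof (rule abelian_groupI)
    fix s assume s: "s \<in> carrier R"
    show "\<exists>t\<in>carrier R. t \<oplus>\<^bsub>R\<^esub> s = \<zero>\<^bsub>R\<^esub>"
    proof
      \<comment> \<open>The additive inverse is obtained as a product with the constant section -1,
        so that closure under products already shows it to be a section.\<close>
      let ?m = "X_restrict \<Sigma> \<rho> (\<lambda>z. -1)"
      have m: "?m \<in> carrier R"
        by (intro X_restrict_closed holomorphic_several_intros)
      then show "?m \<otimes>\<^bsub>R\<^esub> s \<in> carrier R" using s by (rule X_functions_mult_closed)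
      show "?m \<otimes>\<^bsub>R\<^esub> s \<oplus>\<^bsub>R\<^esub> s = \<zero>\<^bsub>R\<^esub>"
      proof (rule ext(6))
        fix p assume p: "p \<in> X"
        with s obtain U h where "p \<in> U"
          "\<And>q. q \<in> U \<Longrightarrow> q \<in> X \<Longrightarrow> h \<in> carrier (germ_ring q) \<and> s q = X_germ \<Sigma> \<rho> q h"
          by (rule X_functions_rep) blast
        with p have h: "h \<in> carrier (germ_ring p)" "s p = X_germ \<Sigma> \<rho> p h" by auto
        then show "(?m \<otimes>\<^bsub>R\<^esub> s \<oplus>\<^bsub>R\<^esub> s) p = \<zero>\<^bsub>R\<^esub> p"
          using p by (simp add: X_restrict_def X_germ_mult X_germ_add X_germ_zero germ_carrier_intros)
      qed
    qed
  next
    show "\<zero>\<^bsub>R\<^esub> \<in> carrier R"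
      unfolding X_restrict_zero by (intro X_restrict_closed holomorphic_several_const)
    show "s \<oplus>\<^bsub>R\<^esub> t \<oplus>\<^bsub>R\<^esub> u = s \<oplus>\<^bsub>R\<^esub> (t \<oplus>\<^bsub>R\<^esub> u)"
      if "s \<in> carrier R" "t \<in> carrier R" "u \<in> carrier R" for s t u
      using that by (intro ext(2)) (simp add: abelian_monoid.a_assoc[OF ring(2)] X_functions_stalk)
    show "s \<oplus>\<^bsub>R\<^esub> t = t \<oplus>\<^bsub>R\<^esub> s" if "s \<in> carrier R" "t \<in> carrier R" for s t
      using that by (intro ext(2)) (simp add: abelian_monoid.a_comm[OF ring(2)] X_functions_stalk)
    show "\<zero>\<^bsub>R\<^esub> \<oplus>\<^bsub>R\<^esub> s = s" if "s \<in> carrier R" for s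
      using that by (intro ext(5)) (simp_all add: abelian_monoid.l_zero[OF ring(2)] X_functions_stalk)
  qed (rule X_functions_add_closed)
  show "Group.comm_monoid R"
  proof (rule Group.comm_monoidI)
    show "\<one>\<^bsub>R\<^esub> \<in> carrier R"
      unfolding X_restrict_one by (intro X_restrict_closed holomorphic_several_const)
    show "s \<otimes>\<^bsub>R\<^esub> t \<otimes>\<^bsub>R\<^esub> u = s \<otimes>\<^bsub>R\<^esub> (t \<otimes>\<^bsub>R\<^esub> u)"
      if "s \<in> carrier R" "t \<in> carrier R" "u \<in> carrier R" for s t u
      using that by (intro ext(1)) (simp add: Group.monoid.m_assoc[OF ring(4)] X_functions_stalk)
    show "s \<otimes>\<^bsub>R\<^esub> t = t \<otimes>\<^bsub>R\<^esub> s" if "s \<in> carrier R" "t \<in> carrier R" for s t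
      using that by (intro ext(1)) (simp add: Group.comm_monoid.m_comm[OF ring(3)] X_functions_stalk)
    show "\<one>\<^bsub>R\<^esub> \<otimes>\<^bsub>R\<^esub> s = s" if "s \<in> carrier R" for s
      using that by (intro ext(4)) (simp_all add: Group.monoid.l_one[OF ring(4)] X_functions_stalk)
  qed (rule X_functions_mult_closed)
  show "(s \<oplus>\<^bsub>R\<^esub> t) \<otimes>\<^bsub>R\<^esub> u = s \<otimes>\<^bsub>R\<^esub> u \<oplus>\<^bsub>R\<^esub> t \<otimes>\<^bsub>R\<^esub> u"
    if "s \<in> carrier R" "t \<in> carrier R" "u \<in> carrier R" for s t u
  proof (rule ext(3))
    fix p assume p: "p \<in> X"
    interpret stalk: cring "X_stalk \<Sigma> \<rho> p" by (rule cring_X_stalk)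
    show "((s \<oplus>\<^bsub>R\<^esub> t) \<otimes>\<^bsub>R\<^esub> u) p = (s \<otimes>\<^bsub>R\<^esub> u \<oplus>\<^bsub>R\<^esub> t \<otimes>\<^bsub>R\<^esub> u) p"
      using p that by (simp add: stalk.l_distr X_functions_stalk)
  qed
qed

text \<open>The union in the definition of \<open>X_log_field\<close> collapses: all representatives
  contribute the same coset, and there is at least one, namely \<open>h\<close>.\<close>

lemma X_log_field_germ:
  assumes "p \<in> X" "h \<in> carrier (germ_ring p)" "s p = X_germ \<Sigma> \<rho> p h"
  shows "X_log_field \<Sigma> \<rho> m s p = X_germ \<Sigma> \<rho> p (log_field \<rho> m h)"
proof -
  have "(\<Union>g\<in>X_germ \<Sigma> \<rho> p h. X_germ \<Sigma> \<rho> p (log_field \<rho> m g)) =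
      (\<Union>g\<in>X_germ \<Sigma> \<rho> p h. X_germ \<Sigma> \<rho> p (log_field \<rho> m h))"
    by (rule SUP_cong[OF refl]) (rule X_germ_cong_log_field[OF assms(2)])
  then show ?thesis
    using X_germ_self[of h p] assms by (auto simp: X_log_field_def)
qed

lemma X_log_field_closed:
  assumes "s \<in> carrier R"
  shows "X_log_field \<Sigma> \<rho> m s \<in> carrier R"
proof (rule X_functions_carrierI)
  fix p assume "p \<in> X"
  with assms obtain U h where "open U" "p \<in> U" "holomorphic_several h U"
    "\<And>q. q \<in> U \<Longrightarrow> q \<in> X \<Longrightarrow> h \<in> carrier (germ_ring q) \<and> s q = X_germ \<Sigma> \<rho> q h"
    by (rule X_functions_rep) blast
  then show "\<exists>U h. open U \<and> p \<in> U \<and> holomorphic_several h U \<and>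
      (\<forall>q\<in>U \<inter> X. X_log_field \<Sigma> \<rho> m s q = X_germ \<Sigma> \<rho> q h)"
    by (intro exI[of _ U] exI[of _ "log_field \<rho> m h"] conjI ballI X_log_field_germ)
      (auto intro: holomorphic_several_log_field)
qed (simp add: X_log_field_def)

lemma X_log_field_add:
  assumes "s \<in> carrier R" "t \<in> carrier R"
  shows "X_log_field \<Sigma> \<rho> m (s \<oplus>\<^bsub>R\<^esub> t) = X_log_field \<Sigma> \<rho> m s \<oplus>\<^bsub>R\<^esub> X_log_field \<Sigma> \<rho> m t"
proof (rule X_functions_eqI)
  fix p assume p: "p \<in> X"
  with assms obtain U g h where U: "open U" "p \<in> U" "holomorphic_several g U" "holomorphic_several h U"
    "\<And>q. q \<in> U \<Longrightarrow> q \<in> X \<Longrightarrow> g \<in> carrier (germ_ring q) \<and> h \<in> carrier (germ_ring q) \<and>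
      s q = X_germ \<Sigma> \<rho> q g \<and> t q = X_germ \<Sigma> \<rho> q h"
    by (rule X_functions_rep2) blast
  then have gh: "g \<in> carrier (germ_ring p)" "h \<in> carrier (germ_ring p)"
      "s p = X_germ \<Sigma> \<rho> p g" "t p = X_germ \<Sigma> \<rho> p h"
    using p by auto
  have "X_log_field \<Sigma> \<rho> m (s \<oplus>\<^bsub>R\<^esub> t) p = X_germ \<Sigma> \<rho> p (log_field \<rho> m (\<lambda>z. g z + h z))"
    by (rule X_log_field_germ)
      (use p gh in \<open>auto simp: X_functions_simps X_germ_add intro: germ_carrier_intros\<close>)
  \<comment> \<open>Additivity is known only on \<open>U\<close>. The two functions may differ
    elsewhere, but their difference vanishes near \<open>p\<close> and so lies in the ideal with all
    coefficients zero.\<close>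
  also have "\<dots> = X_germ \<Sigma> \<rho> p (\<lambda>z. log_field \<rho> m g z + log_field \<rho> m h z)"
    by (rule X_germ_eqI, rule SR_idealI[OF U(1,2), of "\<lambda>I z. 0"])
      (auto simp: log_field_add[OF U(1) _ U(3,4)] intro: holomorphic_several_const)
  also have "\<dots> = (X_log_field \<Sigma> \<rho> m s \<oplus>\<^bsub>R\<^esub> X_log_field \<Sigma> \<rho> m t) p"
    using p gh X_log_field_germ[OF p, of g s m] X_log_field_germ[OF p, of h t m]
    by (simp add: X_functions_simps X_germ_add germ_carrier_intros)
  finally show "X_log_field \<Sigma> \<rho> m (s \<oplus>\<^bsub>R\<^esub> t) p =
    (X_log_field \<Sigma> \<rho> m s \<oplus>\<^bsub>R\<^esub> X_log_field \<Sigma> \<rho> m t) p" .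
qed (auto simp: X_log_field_def X_functions_extensional)

lemma X_log_field_restrict:
  assumes "holomorphic_several h UNIV"
  shows "X_log_field \<Sigma> \<rho> m (X_restrict \<Sigma> \<rho> h) = X_restrict \<Sigma> \<rho> (log_field \<rho> m h)"
proof (rule X_functions_eqI)
  fix p assume "p \<in> X"
  then show "X_log_field \<Sigma> \<rho> m (X_restrict \<Sigma> \<rho> h) p = X_restrict \<Sigma> \<rho> (log_field \<rho> m h) p"
    using X_log_field_germ[of p h "X_restrict \<Sigma> \<rho> h" m] germ_carrierI[OF open_UNIV _ assms, of p]
    by (simp add: X_restrict_def)
qed (auto simp: X_log_field_def X_restrict_def)

lemma X_log_field_zero: "X_log_field \<Sigma> \<rho> m \<zero>\<^bsub>R\<^esub> = \<zero>\<^bsub>R\<^esub>"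
proof -
  have "log_field \<rho> m (\<lambda>z. 0) = (\<lambda>z. 0)"
    using log_field_const[OF open_UNIV] by blast
  then show ?thesis
    by (simp add: X_restrict_zero X_log_field_restrict holomorphic_several_const)
qed

end

subsection \<open>The twisted complex\<close>

lemma X_restrict_finsum:
  fixes h :: "'a \<Rightarrow> complex ^ 'd::finite \<Rightarrow> complex"
  assumes "finite A" "\<And>i. i \<in> A \<Longrightarrow> holomorphic_several (h i) UNIV"
  shows "finsum (X_functions \<Sigma> \<rho>) (\<lambda>i. X_restrict \<Sigma> \<rho> (h i)) A =
    X_restrict \<Sigma> \<rho> (\<lambda>z. \<Sum>i\<in>A. h i z)"
proof -
  interpret R: cring "X_functions \<Sigma> \<rho>" by (rule cring_X_functions)
  show ?thesis
    using assms
  proof (induction A rule: finite_induct)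
    case empty
    then show ?case by (simp add: X_restrict_zero)
  next
    case (insert i A)
    then have "finsum (X_functions \<Sigma> \<rho>) (\<lambda>i. X_restrict \<Sigma> \<rho> (h i)) (insert i A) =
        X_restrict \<Sigma> \<rho> (h i) \<oplus>\<^bsub>X_functions \<Sigma> \<rho>\<^esub> X_restrict \<Sigma> \<rho> (\<lambda>z. \<Sum>i\<in>A. h i z)"
      by (subst R.finsum_insert) (auto intro: X_restrict_closed)
    also have "\<dots> = X_restrict \<Sigma> \<rho> (\<lambda>z. h i z + (\<Sum>i\<in>A. h i z))"
      using insert by (intro X_restrict_add holomorphic_several_sum) auto
    finally show ?case using insert by simp
  qed
qed

text \<open>Congruence is demanded in every stalk. This is how monomials of sets of rays without a
  common cone are discarded later.\<close>

lemma X_restrict_cong_SR_ideal: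
  assumes "\<And>p. (\<lambda>z. g z - h z) \<in> SR_ideal \<Sigma> \<rho> p"
  shows "X_restrict \<Sigma> \<rho> g = X_restrict \<Sigma> \<rho> h"
  unfolding X_restrict_def by (rule restrict_ext) (rule X_germ_eqI[OF assms])

context
  fixes \<Sigma> :: "'n::{finite,linorder} cone set" and \<rho> :: "'d::finite \<Rightarrow> 'n lattice"
    and e :: "'n \<Rightarrow> 'n lattice \<Rightarrow> int"
begin

interpretation R: cring "X_functions \<Sigma> \<rho>" by (rule cring_X_functions)

private abbreviation (input) "\<O> \<equiv> X_functions \<Sigma> \<rho>"
private abbreviation (input) "P \<equiv> polyvector_series \<Sigma> \<rho>"
private abbreviation (input) "f \<equiv> superpotential \<Sigma> \<rho>"
private abbreviation (input) "L \<equiv> brieskorn_lattice \<Sigma> \<rho> e"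

section \<open>Additivity of the twisted differential\<close>

lemma superpotential_closed: "f \<in> carrier \<O>"
  unfolding superpotential_def by (intro X_restrict_closed holomorphic_several_intros)

lemma polyvector_series_simps [simp]:
  "a \<in> carrier P \<longleftrightarrow> (\<forall>j S. a j S \<in> carrier \<O>)"
  "a \<otimes>\<^bsub>P\<^esub> c = (\<lambda>j S. a j S \<oplus>\<^bsub>\<O>\<^esub> c j S)"
  "\<one>\<^bsub>P\<^esub> = (\<lambda>j S. \<zero>\<^bsub>\<O>\<^esub>)"
  by (simp_all add: polyvector_series_def)

lemma comm_group_polyvector_series: "comm_group P"
proof (rule comm_groupI)
  show "\<exists>c\<in>carrier P. c \<otimes>\<^bsub>P\<^esub> a = \<one>\<^bsub>P\<^esub>" if "a \<in> carrier P" for a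
    by (rule bexI[of _ "\<lambda>j S. \<ominus>\<^bsub>\<O>\<^esub> a j S"]) (use that in \<open>auto simp: R.l_neg\<close>)
qed (auto simp: R.a_ac)

interpretation P: comm_group P by (rule comm_group_polyvector_series)

lemma inv_polyvector_series: "a \<in> carrier P \<Longrightarrow> inv\<^bsub>P\<^esub> a = (\<lambda>j S. \<ominus>\<^bsub>\<O>\<^esub> a j S)"
  by (rule P.inv_equality) (auto simp: R.l_neg)

lemma frame_derivation_closed:
  "(\<And>S. A S \<in> carrier \<O>) \<Longrightarrow> frame_derivation \<Sigma> \<rho> k A S \<in> carrier \<O>"
  by (simp add: frame_derivation_def)

lemma frame_derivation_add:
  "(\<And>S. A S \<in> carrier \<O>) \<Longrightarrow> (\<And>S. C S \<in> carrier \<O>) \<Longrightarrow>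
    frame_derivation \<Sigma> \<rho> k (\<lambda>S. A S \<oplus>\<^bsub>\<O>\<^esub> C S) S =
    frame_derivation \<Sigma> \<rho> k A S \<oplus>\<^bsub>\<O>\<^esub> frame_derivation \<Sigma> \<rho> k C S"
  by (simp add: frame_derivation_def R.minus_add)

text \<open>The coefficient at \<open>S\<close> reads only the one at \<open>insert k S\<close>. All
  statements about degrees below come from this shift by one element.\<close>

lemma frame_derivation_zero:
  "(k \<notin> S \<Longrightarrow> A (insert k S) = \<zero>\<^bsub>\<O>\<^esub>) \<Longrightarrow> frame_derivation \<Sigma> \<rho> k A S = \<zero>\<^bsub>\<O>\<^esub>"
  by (simp add: frame_derivation_def)

lemma bracket_closed:
  "(\<And>S. A S \<in> carrier \<O>) \<Longrightarrow> bracket \<Sigma> \<rho> e f A S \<in> carrier \<O>"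
  unfolding bracket_def
  by (intro R.finsum_closed Pi_I R.m_closed X_log_field_closed superpotential_closed
      frame_derivation_closed)

lemma bracket_add:
  assumes "\<And>S. A S \<in> carrier \<O>" "\<And>S. C S \<in> carrier \<O>"
  shows "bracket \<Sigma> \<rho> e f (\<lambda>S. A S \<oplus>\<^bsub>\<O>\<^esub> C S) S = bracket \<Sigma> \<rho> e f A S \<oplus>\<^bsub>\<O>\<^esub> bracket \<Sigma> \<rho> e f C S"
  unfolding bracket_def using assms
  by (subst R.finsum_addf[symmetric])
    (auto simp: frame_derivation_add R.r_distr frame_derivation_closed X_log_field_closed
      superpotential_closed)

lemma bracket_zero:
  assumes "\<And>k. k \<notin> S \<Longrightarrow> A (insert k S) = \<zero>\<^bsub>\<O>\<^esub>"
  shows "bracket \<Sigma> \<rho> e f A S = \<zero>\<^bsub>\<O>\<^esub>"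
  unfolding bracket_def using assms
  by (simp add: frame_derivation_zero X_log_field_closed superpotential_closed)

lemma BV_operator_closed:
  "(\<And>S. A S \<in> carrier \<O>) \<Longrightarrow> BV_operator \<Sigma> \<rho> e A S \<in> carrier \<O>"
  unfolding BV_operator_def
  by (intro R.finsum_closed Pi_I X_log_field_closed frame_derivation_closed)

lemma BV_operator_add:
  assumes "\<And>S. A S \<in> carrier \<O>" "\<And>S. C S \<in> carrier \<O>"
  shows "BV_operator \<Sigma> \<rho> e (\<lambda>S. A S \<oplus>\<^bsub>\<O>\<^esub> C S) S =
    BV_operator \<Sigma> \<rho> e A S \<oplus>\<^bsub>\<O>\<^esub> BV_operator \<Sigma> \<rho> e C S"
  unfolding BV_operator_def using assms
  by (subst R.finsum_addf[symmetric])
    (auto simp: frame_derivation_add X_log_field_add frame_derivation_closed X_log_field_closed)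

lemma BV_operator_zero:
  assumes "\<And>k. k \<notin> S \<Longrightarrow> A (insert k S) = \<zero>\<^bsub>\<O>\<^esub>"
  shows "BV_operator \<Sigma> \<rho> e A S = \<zero>\<^bsub>\<O>\<^esub>"
  unfolding BV_operator_def using assms
  by (simp add: frame_derivation_zero X_log_field_zero)

lemma twisted_differential_closed:
  assumes "a \<in> carrier P"
  shows "twisted_differential \<Sigma> \<rho> e f a \<in> carrier P"
  using assms
  by (auto simp: twisted_differential_def bracket_closed BV_operator_closed split: nat.split)

text \<open>Being a homomorphism makes the boundaries a subgroup, as the image of a subgroup of
  chains.\<close>

lemma twisted_differential_hom: "twisted_differential \<Sigma> \<rho> e f \<in> hom P P"
proof (rule homI)
  fix a c assume a: "a \<in> carrier P" "c \<in> carrier P"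
  show "twisted_differential \<Sigma> \<rho> e f (a \<otimes>\<^bsub>P\<^esub> c) =
    twisted_differential \<Sigma> \<rho> e f a \<otimes>\<^bsub>P\<^esub> twisted_differential \<Sigma> \<rho> e f c"
  proof (rule ext, rule ext)
    fix j S
    show "twisted_differential \<Sigma> \<rho> e f (a \<otimes>\<^bsub>P\<^esub> c) j S =
      (twisted_differential \<Sigma> \<rho> e f a \<otimes>\<^bsub>P\<^esub> twisted_differential \<Sigma> \<rho> e f c) j S"
      using a by (cases j)
        (simp_all add: twisted_differential_def bracket_add BV_operator_add
          bracket_closed BV_operator_closed R.a_ac)
  qed
qed (rule twisted_differential_closed)

section \<open>Cycles, boundaries and the quotient group\<close>

lemma degree_chains_subgroup: "subgroup (degree_chains \<Sigma> \<rho> q) P"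
proof (rule subgroup.intro)
  show "inv\<^bsub>P\<^esub> a \<in> degree_chains \<Sigma> \<rho> q" if "a \<in> degree_chains \<Sigma> \<rho> q" for a
    using that inv_polyvector_series[of a] by (auto simp: degree_chains_def)
qed (auto simp: degree_chains_def)

lemma degree_chains_zero:
  "a \<in> degree_chains \<Sigma> \<rho> q \<Longrightarrow> card S \<noteq> q \<Longrightarrow> a j S = \<zero>\<^bsub>\<O>\<^esub>"
  by (simp add: degree_chains_def)

lemma twisted_differential_degree:
  assumes "a \<in> degree_chains \<Sigma> \<rho> (Suc q)"
  shows "twisted_differential \<Sigma> \<rho> e f a \<in> degree_chains \<Sigma> \<rho> q"
proof -
  have "twisted_differential \<Sigma> \<rho> e f a j S = \<zero>\<^bsub>\<O>\<^esub>" if "card S \<noteq> q" for j S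
  proof -
    have "a j (insert k S) = \<zero>\<^bsub>\<O>\<^esub>" if "k \<notin> S" for j k
      using degree_chains_zero[OF assms] that \<open>card S \<noteq> q\<close> by simp
    then show ?thesis
      by (simp add: twisted_differential_def bracket_zero BV_operator_zero split: nat.split)
  qed
  moreover have "twisted_differential \<Sigma> \<rho> e f a \<in> carrier P"
    using assms twisted_differential_closed by (simp add: degree_chains_def)
  ultimately show ?thesis by (simp add: degree_chains_def)
qed

text \<open>A set \<open>insert k S\<close> is never empty, so a chain of degree 0 has nothing to
  contract. Hence every function is a cycle and has a class.\<close>

lemma degree_cycles_0: "degree_cycles \<Sigma> \<rho> e f 0 = degree_chains \<Sigma> \<rho> 0"
proof -
  have "twisted_differential \<Sigma> \<rho> e f a = \<one>\<^bsub>P\<^esub>" if "a \<in> degree_chains \<Sigma> \<rho> 0" for a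
  proof (rule ext, rule ext)
    fix j S
    have "a i (insert k S) = \<zero>\<^bsub>\<O>\<^esub>" for i k
      using degree_chains_zero[OF that] by (simp add: card_eq_0_iff)
    then show "twisted_differential \<Sigma> \<rho> e f a j S = \<one>\<^bsub>P\<^esub> j S"
      by (simp add: twisted_differential_def bracket_zero BV_operator_zero split: nat.split)
  qed
  then show ?thesis by (auto simp: degree_cycles_def)
qed

private abbreviation (input) "B \<equiv> degree_boundaries \<Sigma> \<rho> e f 0"
private abbreviation (input) "C \<equiv> P\<lparr>carrier := degree_chains \<Sigma> \<rho> 0\<rparr>"

lemma degree_boundaries_subgroup: "subgroup B P"
proof -
  interpret group_hom P P "twisted_differential \<Sigma> \<rho> e f"
    by (rule group_hom.intro) (auto intro: group_hom_axioms.intro twisted_differential_hom)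
  show ?thesis
    unfolding degree_boundaries_def
    by (rule subgroup_img_is_subgroup[OF degree_chains_subgroup])
qed

lemma comm_group_cycles: "comm_group C"
proof (rule group.group_comm_groupI[OF P.subgroup_imp_group[OF degree_chains_subgroup]])
  fix a c assume "a \<in> carrier C" "c \<in> carrier C"
  then show "a \<otimes>\<^bsub>C\<^esub> c = c \<otimes>\<^bsub>C\<^esub> a"
    using P.m_comm[of a c] by (simp add: degree_chains_def)
qed

lemma degree_boundaries_subgroup_cycles: "subgroup B C"
  by (rule P.subgroup_incl[OF degree_boundaries_subgroup degree_chains_subgroup])
    (auto simp: degree_boundaries_def intro: twisted_differential_degree)

lemma brieskorn_lattice_eq: "L = C Mod B"
  by (simp add: brieskorn_lattice_def twisted_cohomology_def degree_cycles_0)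

lemma comm_group_brieskorn_lattice: "comm_group L"
  unfolding brieskorn_lattice_eq
  by (rule comm_group.abelian_FactGroup[OF comm_group_cycles degree_boundaries_subgroup_cycles])

text \<open>Cosets depend on the multiplication alone. This reconciles classes, defined by cosets in
  the group of all series, with the quotient of the group of cycles.\<close>

lemma r_coset_cycles: "B #>\<^bsub>C\<^esub> a = B #>\<^bsub>P\<^esub> a"
  by (simp add: r_coset_def)

lemma brieskorn_class_eq: "brieskorn_class \<Sigma> \<rho> e h = B #>\<^bsub>C\<^esub> function_series \<Sigma> \<rho> h"
  by (simp add: brieskorn_class_def r_coset_cycles)

section \<open>Arithmetic of Brieskorn classes\<close>

lemma function_series_cycle:
  "holomorphic_several h UNIV \<Longrightarrow> function_series \<Sigma> \<rho> h \<in> carrier C"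
  by (auto simp: function_series_def degree_chains_def X_restrict_closed)

lemma function_series_add:
  assumes "holomorphic_several g UNIV" "holomorphic_several h UNIV"
  shows "function_series \<Sigma> \<rho> (\<lambda>z. g z + h z) = function_series \<Sigma> \<rho> g \<otimes>\<^bsub>P\<^esub> function_series \<Sigma> \<rho> h"
  by (rule ext, rule ext) (auto simp: function_series_def X_restrict_add assms)

interpretation L: comm_group L by (rule comm_group_brieskorn_lattice)

lemma r_coset_hom: "(\<lambda>a. B #>\<^bsub>C\<^esub> a) \<in> hom C L"
proof -
  interpret C: comm_group C by (rule comm_group_cycles)
  show ?thesis
    unfolding brieskorn_lattice_eq
    by (rule normal.r_coset_hom_Mod[OF C.subgroup_imp_normal[OF degree_boundaries_subgroup_cycles]])
qed

lemma brieskorn_class_closed: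
  "holomorphic_several h UNIV \<Longrightarrow> brieskorn_class \<Sigma> \<rho> e h \<in> carrier L"
  unfolding brieskorn_class_eq by (rule hom_in_carrier[OF r_coset_hom function_series_cycle])

lemma brieskorn_class_add:
  assumes "holomorphic_several g UNIV" "holomorphic_several h UNIV"
  shows "brieskorn_class \<Sigma> \<rho> e (\<lambda>z. g z + h z) =
    brieskorn_class \<Sigma> \<rho> e g \<otimes>\<^bsub>L\<^esub> brieskorn_class \<Sigma> \<rho> e h"
  unfolding brieskorn_class_eq function_series_add[OF assms]
  using hom_mult[OF r_coset_hom function_series_cycle[OF assms(1)] function_series_cycle[OF assms(2)]]
  by simp

lemma brieskorn_class_zero: "brieskorn_class \<Sigma> \<rho> e (\<lambda>z. 0) = \<one>\<^bsub>L\<^esub>"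
  using brieskorn_class_add[of "\<lambda>z. 0" "\<lambda>z. 0"] brieskorn_class_closed[of "\<lambda>z. 0"]
  by (simp add: holomorphic_several_const)

lemma brieskorn_class_minus:
  assumes "holomorphic_several h UNIV"
  shows "brieskorn_class \<Sigma> \<rho> e (\<lambda>z. - h z) = inv\<^bsub>L\<^esub> brieskorn_class \<Sigma> \<rho> e h"
  using brieskorn_class_add[OF holomorphic_several_minus[OF assms] assms] assms
  by (intro L.inv_equality[symmetric])
    (simp_all add: brieskorn_class_zero brieskorn_class_closed holomorphic_several_minus)

lemma brieskorn_class_of_nat:
  assumes "holomorphic_several h UNIV"
  shows "brieskorn_class \<Sigma> \<rho> e (\<lambda>z. of_nat n * h z) = brieskorn_class \<Sigma> \<rho> e h [^]\<^bsub>L\<^esub> n"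
proof (induction n)
  case 0
  then show ?case by (simp add: brieskorn_class_zero)
next
  case (Suc n)
  have "brieskorn_class \<Sigma> \<rho> e (\<lambda>z. of_nat (Suc n) * h z) =
      brieskorn_class \<Sigma> \<rho> e (\<lambda>z. of_nat n * h z + h z)"
    by (simp add: algebra_simps)
  also have "\<dots> = brieskorn_class \<Sigma> \<rho> e (\<lambda>z. of_nat n * h z) \<otimes>\<^bsub>L\<^esub> brieskorn_class \<Sigma> \<rho> e h"
    by (intro brieskorn_class_add holomorphic_several_intros assms)
  finally show ?case by (simp add: Suc)
qed

text \<open>The quotient is treated only as an abelian group, so integer coefficients inside a class
  must become integer powers: natural multiples by induction, negative ones through
  inverses.\<close>

lemma brieskorn_class_of_int:
  assumes "holomorphic_several h UNIV"
  shows "brieskorn_class \<Sigma> \<rho> e (\<lambda>z. of_int m * h z) = brieskorn_class \<Sigma> \<rho> e h [^]\<^bsub>L\<^esub> m"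
proof (cases m rule: int_cases2)
  case (nonneg n)
  then show ?thesis
    using brieskorn_class_of_nat[OF assms, of n] by (simp only: int_pow_int of_int_of_nat_eq)
next
  case (nonpos n)
  have "brieskorn_class \<Sigma> \<rho> e (\<lambda>z. of_int m * h z) =
      brieskorn_class \<Sigma> \<rho> e (\<lambda>z. - (of_nat n * h z))"
    by (simp only: nonpos of_int_minus of_int_of_nat_eq mult_minus_left)
  also have "\<dots> = inv\<^bsub>L\<^esub> brieskorn_class \<Sigma> \<rho> e (\<lambda>z. of_nat n * h z)"
    by (intro brieskorn_class_minus holomorphic_several_intros assms)
  also have "\<dots> = inv\<^bsub>L\<^esub> (brieskorn_class \<Sigma> \<rho> e h [^]\<^bsub>L\<^esub> n)"
    by (simp only: brieskorn_class_of_nat[OF assms])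
  also have "\<dots> = brieskorn_class \<Sigma> \<rho> e h [^]\<^bsub>L\<^esub> m"
    by (simp only: nonpos L.int_pow_neg_int brieskorn_class_closed[OF assms])
  finally show ?thesis .
qed

lemma brieskorn_class_int_combination:
  assumes "finite I" "\<And>i. i \<in> I \<Longrightarrow> holomorphic_several (h i) UNIV"
  shows "brieskorn_class \<Sigma> \<rho> e (\<lambda>z. \<Sum>i\<in>I. of_int (m i) * h i z) =
    finprod L (\<lambda>i. brieskorn_class \<Sigma> \<rho> e (h i) [^]\<^bsub>L\<^esub> (m i :: int)) I"
  using assms
proof (induction I rule: finite_induct)
  case empty
  then show ?case by (simp add: brieskorn_class_zero)
next
  case (insert i I)
  have "brieskorn_class \<Sigma> \<rho> e (\<lambda>z. \<Sum>i\<in>insert i I. of_int (m i) * h i z) =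
      brieskorn_class \<Sigma> \<rho> e (\<lambda>z. of_int (m i) * h i z + (\<Sum>i\<in>I. of_int (m i) * h i z))"
    using insert by simp
  also have "\<dots> = brieskorn_class \<Sigma> \<rho> e (\<lambda>z. of_int (m i) * h i z) \<otimes>\<^bsub>L\<^esub>
      brieskorn_class \<Sigma> \<rho> e (\<lambda>z. \<Sum>i\<in>I. of_int (m i) * h i z)"
    using insert.prems by (intro brieskorn_class_add holomorphic_several_intros) auto
  also have "\<dots> = finprod L (\<lambda>i. brieskorn_class \<Sigma> \<rho> e (h i) [^]\<^bsub>L\<^esub> m i) (insert i I)"
    using insert
    by (subst L.finprod_insert) (auto simp: brieskorn_class_of_int brieskorn_class_closed)
  finally show ?case .
qed

lemma brieskorn_class_cong_SR_ideal:
  assumes "\<And>p. (\<lambda>z. g z - h z) \<in> SR_ideal \<Sigma> \<rho> p"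
  shows "brieskorn_class \<Sigma> \<rho> e g = brieskorn_class \<Sigma> \<rho> e h"
  unfolding brieskorn_class_def function_series_def X_restrict_cong_SR_ideal[OF assms] ..

text \<open>The relation comes from the chain \<open>z\<^sup>T \<theta>\<^sub>m\<close>, where \<open>\<theta>\<^sub>m = \<Sum>\<^sub>k c\<^sub>k \<theta>\<^sub>k\<close>.  Its \<open>u\<close>-part
  \<open>\<theta>\<^sub>m(z\<^sup>T)\<close> vanishes since \<open>m\<close> is zero on the rays in \<open>T\<close>.\<close>

lemma brieskorn_class_relation:
  assumes m: "\<And>i. m (\<rho> i) = (\<Sum>k\<in>UNIV. c k * e k (\<rho> i))"
    and T: "\<And>i. i \<in> T \<Longrightarrow> m (\<rho> i) = 0"
  shows "brieskorn_class \<Sigma> \<rho> e (\<lambda>z. (\<Prod>i\<in>T. z $ i) * (\<Sum>i\<in>UNIV. of_int (m (\<rho> i)) * z $ i)) = \<one>\<^bsub>L\<^esub>"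
proof -
  define g where "g k z = of_int (c k) * (\<Prod>i\<in>T. z $ i)" for k and z :: "complex ^ 'd"
  have g: "holomorphic_several (g k) UNIV" for k
    unfolding g_def[abs_def] by (intro holomorphic_several_intros)
  \<comment> \<open>The chain has constant term only in u and is supported on singletons, where
    \<open>the_elem\<close> recovers the index of the frame vector.\<close>
  define a where "a = (\<lambda>(j::nat) S. if j = 0 \<and> card S = 1 then X_restrict \<Sigma> \<rho> (g (the_elem S)) else \<zero>\<^bsub>\<O>\<^esub>)"
  define h where "h z = (\<Prod>i\<in>T. z $ i) * (\<Sum>i\<in>UNIV. of_int (m (\<rho> i)) * z $ i)" for z :: "complex ^ 'd"
  have a: "a \<in> degree_chains \<Sigma> \<rho> (Suc 0)"
    by (auto simp: a_def degree_chains_def X_restrict_closed g)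
  \<comment> \<open>Only the empty set at \<open>j = 0\<close> survives, with positive sign since it
    contains no index below \<open>k\<close>.\<close>
  have frame: "frame_derivation \<Sigma> \<rho> k (a j) S =
      (if j = 0 \<and> S = {} then X_restrict \<Sigma> \<rho> (g k) else \<zero>\<^bsub>\<O>\<^esub>)" for j k S
  proof (cases "j = 0 \<and> S = {}")
    case True
    then show ?thesis by (simp add: frame_derivation_def a_def)
  next
    case False
    have "a j (insert k S) = \<zero>\<^bsub>\<O>\<^esub>" if "k \<notin> S"
      using that False by (auto simp: a_def card_eq_0_iff)
    then have "frame_derivation \<Sigma> \<rho> k (a j) S = \<zero>\<^bsub>\<O>\<^esub>" by (rule frame_derivation_zero)
    with False show ?thesis by auto
  qed
  have theta_f: "log_field \<rho> (e k) (\<lambda>z. \<Sum>i\<in>UNIV. z $ i) z = (\<Sum>i\<in>UNIV. of_int (e k (\<rho> i)) * z $ i)"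
    for k and z :: "complex ^ 'd"
    by (subst log_field_sum[OF open_UNIV])
      (auto intro: holomorphic_several_coord simp: log_field_coord)
  have theta_g: "log_field \<rho> (e k) (g k) z = of_int (c k) * (\<Sum>i\<in>T. of_int (e k (\<rho> i))) * (\<Prod>i\<in>T. z $ i)"
    for k and z :: "complex ^ 'd"
    unfolding g_def[abs_def]
    by (subst log_field_mult[OF open_UNIV])
      (auto intro!: holomorphic_several_intros
        simp: log_field_const[OF open_UNIV] log_field_coord_prod)
  have bracket: "bracket \<Sigma> \<rho> e f (a j) S = function_series \<Sigma> \<rho> h j S" for j S
  proof (cases "j = 0 \<and> S = {}")
    case True
    have "bracket \<Sigma> \<rho> e f (a j) S = finsum \<O> (\<lambda>k.
        X_restrict \<Sigma> \<rho> (log_field \<rho> (e k) (\<lambda>z. \<Sum>i\<in>UNIV. z $ i)) \<otimes>\<^bsub>\<O>\<^esub> X_restrict \<Sigma> \<rho> (g k)) UNIV"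
      using True by (simp add: bracket_def frame superpotential_def X_log_field_restrict
          holomorphic_several_sum holomorphic_several_coord)
    also have "\<dots> = finsum \<O> (\<lambda>k. X_restrict \<Sigma> \<rho>
        (\<lambda>z. (\<Sum>i\<in>UNIV. of_int (e k (\<rho> i)) * z $ i) * g k z)) UNIV"
      unfolding theta_f[abs_def] by (subst X_restrict_mult) (auto intro!: holomorphic_several_intros g)
    also have "\<dots> = X_restrict \<Sigma> \<rho>
        (\<lambda>z. \<Sum>k\<in>UNIV. (\<Sum>i\<in>UNIV. of_int (e k (\<rho> i)) * z $ i) * g k z)"
      by (rule X_restrict_finsum) (auto intro!: holomorphic_several_intros g)
    also have "(\<lambda>z. \<Sum>k\<in>UNIV. (\<Sum>i\<in>UNIV. of_int (e k (\<rho> i)) * z $ i) * g k z) = h"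
    proof
      fix z :: "complex ^ 'd"
      have "(\<Sum>k\<in>UNIV. (\<Sum>i\<in>UNIV. of_int (e k (\<rho> i)) * z $ i) * g k z) =
          (\<Sum>k\<in>UNIV. \<Sum>i\<in>UNIV. (\<Prod>i\<in>T. z $ i) * (of_int (c k * e k (\<rho> i)) * z $ i))"
        by (simp add: g_def sum_distrib_right sum_distrib_left mult_ac)
      \<comment> \<open>Summing over the frame index first lets the expansion of \<open>m\<close>
        assemble the coefficient of each coordinate.\<close>
      also have "\<dots> = (\<Sum>i\<in>UNIV. \<Sum>k\<in>UNIV. (\<Prod>i\<in>T. z $ i) * (of_int (c k * e k (\<rho> i)) * z $ i))"
        by (rule sum.swap)
      also have "\<dots> = h z"
        by (simp add: h_def m sum_distrib_left sum_distrib_right)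
      finally show "(\<Sum>k\<in>UNIV. (\<Sum>i\<in>UNIV. of_int (e k (\<rho> i)) * z $ i) * g k z) = h z" .
    qed
    finally show ?thesis using True by (simp add: function_series_def)
  next
    case False
    then show ?thesis
      unfolding bracket_def frame function_series_def if_not_P[OF False]
      by (simp add: X_log_field_closed superpotential_closed)
  qed
  have BV: "BV_operator \<Sigma> \<rho> e (a j) S = \<zero>\<^bsub>\<O>\<^esub>" for j S
  proof (cases "j = 0 \<and> S = {}")
    case True
    have "BV_operator \<Sigma> \<rho> e (a j) S = finsum \<O> (\<lambda>k. X_restrict \<Sigma> \<rho> (log_field \<rho> (e k) (g k))) UNIV"
      using True by (simp add: BV_operator_def frame X_log_field_restrict g)
    also have "\<dots> = X_restrict \<Sigma> \<rho> (\<lambda>z. \<Sum>k\<in>UNIV. log_field \<rho> (e k) (g k) z)"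
      by (rule X_restrict_finsum) (auto intro!: holomorphic_several_log_field g)
    also have "(\<lambda>z. \<Sum>k\<in>UNIV. log_field \<rho> (e k) (g k) z) = (\<lambda>z. 0)"
    proof
      fix z :: "complex ^ 'd"
      \<comment> \<open>The individual frame fields need not annihilate the monomial; only their
        combination with coefficients \<open>c k\<close> does, which again calls for exchanging the
        sums.\<close>
      have "(\<Sum>k\<in>UNIV. log_field \<rho> (e k) (g k) z) =
          (\<Sum>k\<in>UNIV. \<Sum>i\<in>T. of_int (c k * e k (\<rho> i)) * (\<Prod>i\<in>T. z $ i))"
        by (simp add: theta_g sum_distrib_right sum_distrib_left mult_ac)
      also have "\<dots> = (\<Sum>i\<in>T. \<Sum>k\<in>UNIV. of_int (c k * e k (\<rho> i)) * (\<Prod>i\<in>T. z $ i))"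
        by (rule sum.swap)
      also have "\<dots> = (\<Sum>i\<in>T. of_int (m (\<rho> i)) * (\<Prod>i\<in>T. z $ i))"
        by (simp add: m sum_distrib_right)
      also have "\<dots> = 0" using T by simp
      finally show "(\<Sum>k\<in>UNIV. log_field \<rho> (e k) (g k) z) = 0" .
    qed
    finally show ?thesis by (simp add: X_restrict_zero)
  next
    case False
    then show ?thesis
      unfolding BV_operator_def frame if_not_P[OF False] by (simp add: X_log_field_zero)
  qed
  have h: "holomorphic_several h UNIV"
    unfolding h_def[abs_def] by (intro holomorphic_several_intros)
  have "twisted_differential \<Sigma> \<rho> e f a = function_series \<Sigma> \<rho> h"
  proof (rule ext, rule ext)
    fix j S
    have "function_series \<Sigma> \<rho> h j S \<in> carrier \<O>"
      using function_series_cycle[OF h] by (simp add: degree_chains_def)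
    then show "twisted_differential \<Sigma> \<rho> e f a j S = function_series \<Sigma> \<rho> h j S"
      by (simp add: twisted_differential_def bracket BV split: nat.split)
  qed
  then have "function_series \<Sigma> \<rho> h \<in> B"
    using a unfolding degree_boundaries_def by (metis imageI)
  \<comment> \<open>A boundary has the subgroup \<open>B\<close> itself as its coset, and this coset
    is the unit of the quotient.\<close>
  then have "brieskorn_class \<Sigma> \<rho> e h = B"
    unfolding brieskorn_class_def
    using P.coset_join2[OF _ degree_boundaries_subgroup] function_series_cycle[OF h]
    by (auto simp: degree_chains_def)
  then show ?thesis
    by (simp add: h_def[abs_def] brieskorn_lattice_eq FactGroup_def)
qed

end

subsection \<open>Lattice bases and dual bases\<close>

lemma additive_scale_int:
  fixes m :: "int ^ 'n \<Rightarrow> int"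
  assumes "Modules.additive m"
  shows "m (c *s v) = c * m v"
proof -
  interpret Modules.additive m by fact
  have nat: "m (int n *s v) = int n * m v" for n
    by (induction n) (simp_all add: zero vector_sadd_rdistrib add distrib_right)
  show ?thesis
  proof (cases c rule: int_cases2)
    case (nonpos n)
    have "- (int n) *s v = - (int n *s v)" by (simp add: vec_eq_iff)
    with nonpos show ?thesis by (simp add: minus nat)
  qed (simp add: nat)
qed

lemma additive_lattice_sum:
  fixes m :: "int ^ 'n \<Rightarrow> int"
  assumes "Modules.additive m"
  shows "m (\<Sum>j\<in>A. c j *s \<beta> j) = (\<Sum>j\<in>A. c j * m (\<beta> j))"
proof -
  interpret Modules.additive m by fact
  show ?thesis by (simp add: sum additive_scale_int[OF assms])
qed

text \<open>The real pairing is built from the values of \<open>m\<close> on unit vectors alone;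
  additivity recovers \<open>m\<close> on all lattice vectors from them.\<close>

lemma pairing_real_vec:
  assumes "m \<in> M_lattice"
  shows "pairing m (real_vec v) = real_of_int (m v)"
proof -
  have m: "Modules.additive m" using assms by (simp add: M_lattice_def)
  have "m v = m (\<Sum>j\<in>UNIV. v $ j *s axis j 1)"
    by (simp add: basis_expansion)
  also have "\<dots> = (\<Sum>j\<in>UNIV. v $ j * m (axis j 1))"
    by (rule additive_lattice_sum[OF m])
  finally show ?thesis by (simp add: pairing_def real_vec_def mult.commute)
qed

lemma pairing_eq_inner: "pairing m v = (\<chi> j. real_of_int (m (axis j 1))) \<bullet> v"
  by (simp add: pairing_def inner_vec_def)

lemma linear_pairing: "linear (pairing m)"
  unfolding pairing_eq_inner[abs_def] by (rule bounded_linear.linear[OF bounded_linear_inner_right])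

lemma real_vec_scale_int: "real_vec (c *s v) = real_of_int c *\<^sub>R real_vec v"
  by (simp add: real_vec_def vec_eq_iff)

lemma real_vec_sum: "real_vec (\<Sum>j\<in>A. f j) = (\<Sum>j\<in>A. real_vec (f j))"
  by (simp add: real_vec_def vec_eq_iff)

lemma real_vec_axis: "real_vec (axis j 1) = axis j 1"
  by (simp add: real_vec_def vec_eq_iff axis_def)

lemma real_vec_inject: "real_vec v = real_vec w \<longleftrightarrow> v = w"
  by (simp add: real_vec_def vec_eq_iff)

text \<open>For a lattice basis \<beta> these functions of \<open>v\<close> form the dual basis of
  M; the description by \<open>THE\<close> is meaningful only in that case.\<close>

definition basis_coord :: "('n::finite \<Rightarrow> 'n lattice) \<Rightarrow> 'n \<Rightarrow> 'n lattice \<Rightarrow> int"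
  where "basis_coord \<beta> j v = (THE c. v = (\<Sum>j\<in>UNIV. c j *s \<beta> j)) j"

context
  fixes \<beta> :: "'n::finite \<Rightarrow> 'n lattice"
  assumes \<beta>: "lattice_basis \<beta>"
begin

lemma basis_coord_unique:
  assumes "v = (\<Sum>j\<in>UNIV. c j *s \<beta> j)"
  shows "basis_coord \<beta> j v = c j"
  using \<beta> assms unfolding lattice_basis_def basis_coord_def
  by (subst the1_equality[of _ c]) auto

lemma basis_coord_expansion: "v = (\<Sum>j\<in>UNIV. basis_coord \<beta> j v *s \<beta> j)"
proof -
  obtain c where "v = (\<Sum>j\<in>UNIV. c j *s \<beta> j)"
    using \<beta> unfolding lattice_basis_def by metis
  then show ?thesis using basis_coord_unique by simp
qed

lemma basis_coord_M_lattice: "basis_coord \<beta> j \<in> M_lattice"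
  unfolding M_lattice_def mem_Collect_eq
proof
  fix v w
  have "v + w = (\<Sum>j\<in>UNIV. (basis_coord \<beta> j v + basis_coord \<beta> j w) *s \<beta> j)"
    using basis_coord_expansion[of v] basis_coord_expansion[of w]
    by (simp add: vector_sadd_rdistrib sum.distrib)
  then show "basis_coord \<beta> j (v + w) = basis_coord \<beta> j v + basis_coord \<beta> j w"
    by (rule basis_coord_unique)
qed

lemma basis_coord_basis: "basis_coord \<beta> j (\<beta> l) = (if j = l then 1 else 0)"
proof (rule basis_coord_unique)
  have "(\<Sum>j\<in>UNIV. (if j = l then 1 else 0) *s \<beta> j) = (\<Sum>j\<in>UNIV. if j = l then \<beta> j else 0)"
    by (rule sum.cong) auto
  then show "\<beta> l = (\<Sum>j\<in>UNIV. (if j = l then 1 else 0) *s \<beta> j)" by simp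
qed

lemma lattice_basis_inj: "inj \<beta>"
  by (rule injI) (metis basis_coord_basis zero_neq_one)

lemma lattice_basis_primitive: "primitive (\<beta> j)"
  unfolding primitive_def
proof (intro conjI allI impI)
  show "\<beta> j \<noteq> 0"
  proof
    assume "\<beta> j = 0"
    then have "basis_coord \<beta> j (0 *s \<beta> j) = 1" using basis_coord_basis[of j j] by simp
    then show False
      using basis_coord_M_lattice[of j] additive_scale_int[of "basis_coord \<beta> j" 0 "\<beta> j"]
      by (simp add: M_lattice_def)
  qed
  fix c w assume "\<beta> j = c *s w"
  then have "c * basis_coord \<beta> j w = 1"
    using basis_coord_basis[of j j] basis_coord_M_lattice[of j]
      additive_scale_int[of "basis_coord \<beta> j" c w] by (simp add: M_lattice_def)
  then show "\<bar>c\<bar> = 1" by (auto simp: zmult_eq_1_iff)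
qed

section \<open>Real coordinates and cones over part of a lattice basis\<close>

definition coord :: "'n \<Rightarrow> real ^ 'n \<Rightarrow> real"
  where "coord j = pairing (basis_coord \<beta> j)"

lemma linear_coord: "linear (coord j)"
  unfolding coord_def by (rule linear_pairing)

lemma coord_real_vec: "coord j (real_vec v) = real_of_int (basis_coord \<beta> j v)"
  unfolding coord_def by (rule pairing_real_vec[OF basis_coord_M_lattice])

lemma coord_basis: "coord j (real_vec (\<beta> l)) = (if j = l then 1 else 0)"
  by (simp add: coord_real_vec basis_coord_basis)

text \<open>Both sides are linear in \<open>v\<close>, so it suffices to treat the standard unit
  vectors. These are integral, and there the expansion in the lattice applies.\<close>

lemma coord_expansion: "v = (\<Sum>j\<in>UNIV. coord j v *\<^sub>R real_vec (\<beta> j))"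
proof -
  let ?T = "\<lambda>v. \<Sum>j\<in>UNIV. coord j v *\<^sub>R real_vec (\<beta> j)"
  have lin: "linear ?T"
    by (intro linear_compose_sum ballI linear_compose_scale_right linearI)
      (simp_all add: linear_add[OF linear_coord] linear_cmul[OF linear_coord] scaleR_add_left)
  have eq: "?T (axis i 1) = axis i 1" for i
  proof -
    have "?T (real_vec (axis i 1)) = real_vec (\<Sum>j\<in>UNIV. basis_coord \<beta> j (axis i 1) *s \<beta> j)"
      by (simp add: real_vec_sum real_vec_scale_int coord_real_vec)
    also have "\<dots> = real_vec (axis i 1)"
      by (simp flip: basis_coord_expansion)
    finally show ?thesis by (simp add: real_vec_axis)
  qed
  have v: "(\<Sum>i\<in>UNIV. v $ i *\<^sub>R axis i 1) = v"
    by (simp add: basis_expansion flip: scalar_mult_eq_scaleR)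
  then have "?T v = ?T (\<Sum>i\<in>UNIV. v $ i *\<^sub>R axis i 1)"
    by simp
  also have "\<dots> = (\<Sum>i\<in>UNIV. v $ i *\<^sub>R ?T (axis i 1))"
    by (simp only: linear_sum[OF lin] linear_cmul[OF lin])
  also have "\<dots> = v"
    by (simp only: eq v)
  finally show ?thesis by simp
qed

text \<open>The conditions on the right define a convex cone containing the generators; conversely,
  the coordinate expansion is a nonnegative combination of them. Questions about such cones thereby
  become questions about signs of coordinates.\<close>

lemma mem_basis_cone_iff:
  "v \<in> convex_cone hull (real_vec ` \<beta> ` J) \<longleftrightarrow>
    (\<forall>j. 0 \<le> coord j v \<and> (j \<notin> J \<longrightarrow> coord j v = 0))"
proof
  let ?K = "{v. \<forall>j. 0 \<le> coord j v \<and> (j \<notin> J \<longrightarrow> coord j v = 0)}"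
  have "convex_cone hull (real_vec ` \<beta> ` J) \<subseteq> ?K"
  proof (rule hull_minimal)
    show "convex_cone ?K"
      by (auto simp: convex_cone_iff linear_0[OF linear_coord] linear_add[OF linear_coord]
          linear_cmul[OF linear_coord])
  qed (auto simp: coord_basis)
  then show "\<forall>j. 0 \<le> coord j v \<and> (j \<notin> J \<longrightarrow> coord j v = 0)"
    if "v \<in> convex_cone hull (real_vec ` \<beta> ` J)"
    using that by auto
next
  assume v: "\<forall>j. 0 \<le> coord j v \<and> (j \<notin> J \<longrightarrow> coord j v = 0)"
  let ?H = "convex_cone hull (real_vec ` \<beta> ` J)"
  have "(\<Sum>j\<in>A. coord j v *\<^sub>R real_vec (\<beta> j)) \<in> ?H" if "finite A" for A
    using that
  proof (induction A rule: finite_induct)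
    case (insert j A)
    have "coord j v *\<^sub>R real_vec (\<beta> j) \<in> ?H"
    proof (cases "j \<in> J")
      case True
      then have "real_vec (\<beta> j) \<in> ?H" by (auto intro: hull_inc)
      with v show ?thesis by (simp add: convex_cone_hull_mul)
    qed (use v convex_cone_hull_contains_0 in simp)
    with insert show ?case by (simp add: convex_cone_hull_add)
  qed (simp add: convex_cone_hull_contains_0)
  from this[of UNIV] show "v \<in> ?H" using coord_expansion[of v] by simp
qed

text \<open>The supporting functional is the sum of the dual coordinates in \<open>J - J'\<close>:
  it is nonnegative on the large cone, and a sum of nonnegative terms vanishes only if each term
  does.\<close>

lemma basis_cone_face:
  assumes "J' \<subseteq> J"
  shows "cone_face (convex_cone hull (real_vec ` \<beta> ` J')) (convex_cone hull (real_vec ` \<beta> ` J))"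
proof -
  let ?H = "\<lambda>J. convex_cone hull (real_vec ` \<beta> ` J)"
  define a :: "real ^ 'n" where "a = (\<Sum>l\<in>J - J'. \<chi> i. real_of_int (basis_coord \<beta> l (axis i 1)))"
  have a: "a \<bullet> v = (\<Sum>l\<in>J - J'. coord l v)" for v
    by (simp add: a_def inner_sum_left coord_def pairing_eq_inner)
  have "?H J' = ?H J \<inter> {v. a \<bullet> v = 0}"
  proof (intro equalityI subsetI)
    fix v assume "v \<in> ?H J'"
    then show "v \<in> ?H J \<inter> {v. a \<bullet> v = 0}"
      using assms by (auto simp: mem_basis_cone_iff a)
  next
    fix v assume v: "v \<in> ?H J \<inter> {v. a \<bullet> v = 0}"
    then have "\<forall>l\<in>J - J'. coord l v = 0"
      by (subst sum_nonneg_eq_0_iff[symmetric]) (auto simp: mem_basis_cone_iff a)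
    with v show "v \<in> ?H J'" by (auto simp: mem_basis_cone_iff)
  qed
  moreover have "?H J \<inter> {v. a \<bullet> v = 0} face_of ?H J"
    by (rule face_of_Int_supporting_hyperplane_ge)
      (auto simp: convex_convex_cone_hull a mem_basis_cone_iff intro: sum_nonneg)
  ultimately show ?thesis
    unfolding cone_face_def using convex_cone_hull_nonempty by metis
qed

lemma dim_basis_cone: "dim (convex_cone hull (real_vec ` \<beta> ` J)) = card J"
proof -
  let ?S = "real_vec ` \<beta> ` J"
  have inj: "inj_on (real_vec \<circ> \<beta>) J"
    using lattice_basis_inj by (auto simp: inj_on_def real_vec_inject)
  have "independent ?S"
  proof (rule independent_if_scalars_zero)
    fix c x assume c: "(\<Sum>x\<in>?S. c x *\<^sub>R x) = 0" and "x \<in> ?S"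
    then obtain l where l: "l \<in> J" "x = real_vec (\<beta> l)" by auto
    have "(\<Sum>x\<in>?S. c x *\<^sub>R x) = (\<Sum>j\<in>J. c (real_vec (\<beta> j)) *\<^sub>R real_vec (\<beta> j))"
      using sum.reindex[OF inj, of "\<lambda>x. c x *\<^sub>R x"] by (simp add: image_comp o_def)
    with c have "coord l (\<Sum>j\<in>J. c (real_vec (\<beta> j)) *\<^sub>R real_vec (\<beta> j)) = 0"
      by (simp add: linear_0[OF linear_coord])
    then have "(\<Sum>j\<in>J. if l = j then c (real_vec (\<beta> j)) else 0) = 0"
      by (simp add: linear_sum[OF linear_coord] linear_cmul[OF linear_coord] coord_basis
          if_distrib cong: if_cong)
    with l show "c x = 0" by simp
  qed simp
  then have "dim ?S = card ?S" by (rule dim_eq_card_independent)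
  also have "card ?S = card J" using card_image[OF inj] by (simp add: image_comp)
  finally have "dim ?S = card J" .
  moreover have "convex_cone hull ?S \<subseteq> span ?S"
    by (rule hull_minimal) (auto intro: span_base convex_cone_span)
  then have "dim (convex_cone hull ?S) \<le> dim ?S"
    using dim_subset dim_span by metis
  moreover have "dim ?S \<le> dim (convex_cone hull ?S)"
    by (rule dim_subset) (rule hull_subset)
  ultimately show ?thesis by simp
qed

text \<open>A face containing an interior point of a segment of the cone contains both endpoints.
  Splitting off one coordinate of \<open>v\<close> therefore puts a basis vector on the ray of
  \<open>v\<close>, and primitivity makes the factor equal to 1.\<close>

lemma ray_face_of_basis_cone:
  assumes v: "primitive v" and face: "convex_cone hull {real_vec v} face_of convex_cone hull (real_vec ` \<beta> ` J)"
  shows "v \<in> \<beta> ` J"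
proof -
  let ?F = "convex_cone hull {real_vec v}" and ?H = "convex_cone hull (real_vec ` \<beta> ` J)"
  have vF: "real_vec v \<in> ?F" by (simp add: hull_inc)
  then have vH: "real_vec v \<in> ?H" using face face_of_imp_subset by blast
  have "\<exists>j. basis_coord \<beta> j v \<noteq> 0"
  proof (rule ccontr)
    assume "\<not> ?thesis"
    then have "v = 0" using basis_coord_expansion[of v] by simp
    with v show False by (simp add: primitive_def)
  qed
  then obtain j where j: "basis_coord \<beta> j v \<noteq> 0" by blast
  with vH have jJ: "j \<in> J" and pos: "coord j (real_vec v) > 0"
    by (auto simp: mem_basis_cone_iff coord_real_vec less_le)
  \<comment> \<open>The factor 2 makes \<open>real_vec v\<close> the midpoint of \<open>x\<close>,
    which carries the \<open>j\<close>-th coordinate, and \<open>y\<close>, which carries all the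
    others.\<close>
  define x where "x = (2 * coord j (real_vec v)) *\<^sub>R real_vec (\<beta> j)"
  define y where "y = 2 *\<^sub>R real_vec v - x"
  have coord_x: "coord l x = (if l = j then 2 * coord j (real_vec v) else 0)" for l
    by (simp add: x_def linear_cmul[OF linear_coord] coord_basis)
  have coord_y: "coord l y = (if l = j then 0 else 2 * coord l (real_vec v))" for l
    by (simp add: y_def linear_diff[OF linear_coord] linear_cmul[OF linear_coord] coord_x)
  have "x \<in> ?H" "y \<in> ?H"
    using vH jJ by (auto simp: mem_basis_cone_iff coord_x coord_y)
  moreover have "x \<noteq> y"
    using coord_x[of j] coord_y[of j] pos by auto
  then have "midpoint x y \<in> open_segment x y"
    by simp
  then have "real_vec v \<in> open_segment x y"
    by (simp add: midpoint_def y_def)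
  ultimately have "x \<in> ?F"
    using face vF unfolding face_of_def by blast
  moreover have "?F \<subseteq> {t *\<^sub>R real_vec v |t. t \<ge> 0}"
  proof (rule hull_minimal)
    have "1 *\<^sub>R real_vec v \<in> {t *\<^sub>R real_vec v |t. t \<ge> 0}"
      by (rule CollectI, intro exI[of _ 1]) simp
    then show "{real_vec v} \<subseteq> {t *\<^sub>R real_vec v |t. t \<ge> 0}" by simp
    show "convex_cone {t *\<^sub>R real_vec v |t. t \<ge> 0}"
      unfolding convex_cone_iff
    proof (intro conjI ballI allI impI)
      show "0 \<in> {t *\<^sub>R real_vec v |t. t \<ge> 0}" by (auto intro: exI[of _ 0])
      show "a + c \<in> {t *\<^sub>R real_vec v |t. t \<ge> 0}"
        if "a \<in> {t *\<^sub>R real_vec v |t. t \<ge> 0}" "c \<in> {t *\<^sub>R real_vec v |t. t \<ge> 0}" for a c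
        using that by (auto simp flip: scaleR_add_left intro: add_nonneg_nonneg)
      show "r *\<^sub>R a \<in> {t *\<^sub>R real_vec v |t. t \<ge> 0}"
        if "a \<in> {t *\<^sub>R real_vec v |t. t \<ge> 0}" "r \<ge> 0" for a r
        using that by (auto intro: mult_nonneg_nonneg)
    qed
  qed
  ultimately obtain t where t: "x = t *\<^sub>R real_vec v" "t \<ge> 0" by auto
  have "coord l x = t * coord l (real_vec v)" for l
    by (simp add: t(1) linear_cmul[OF linear_coord])
  \<comment> \<open>The positive \<open>j\<close>-th coordinate determines \<open>t\<close>; as
    \<open>x\<close> has no other coordinates, neither has \<open>v\<close>.\<close>
  then have "t = 2" "\<And>l. l \<noteq> j \<Longrightarrow> coord l (real_vec v) = 0"
    using coord_x pos by (metis mult_cancel_right order_less_irrefl, metis coord_x mult_eq_0_iff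
        order_less_irrefl pos zero_neq_numeral mult_cancel_right)
  then have "basis_coord \<beta> l v = 0" if "l \<noteq> j" for l
    using that by (simp add: coord_real_vec)
  then have "v = (\<Sum>l\<in>UNIV. if l = j then basis_coord \<beta> j v *s \<beta> j else 0)"
    by (subst basis_coord_expansion[of v], intro sum.cong) auto
  then have "v = basis_coord \<beta> j v *s \<beta> j" by simp
  moreover from this have "\<bar>basis_coord \<beta> j v\<bar> = 1"
    using v unfolding primitive_def by blast
  then have "basis_coord \<beta> j v = 1"
    using pos by (simp add: coord_real_vec)
  ultimately show ?thesis using jJ by simp
qed

end

subsection \<open>Rays of smooth fans\<close>

context
  fixes \<Sigma> :: "'n::finite cone set" and \<rho> :: "'d::finite \<Rightarrow> 'n lattice"
  assumes \<Sigma>: "smooth_fan \<Sigma>" and \<rho>: "bij_betw \<rho> UNIV (primitive_ray_generators \<Sigma>)"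
begin

lemma inj_rays: "inj \<rho>"
  using \<rho> by (simp add: bij_betw_def)

lemma ray_cone: "convex_cone hull {real_vec (\<rho> i)} \<in> \<Sigma>" "primitive (\<rho> i)"
  using \<rho> by (auto simp: bij_betw_def primitive_ray_generators_def)

lemma cone_face_mem: "\<sigma> \<in> \<Sigma> \<Longrightarrow> cone_face \<tau> \<sigma> \<Longrightarrow> \<tau> \<in> \<Sigma>"
  using \<Sigma> by (simp add: smooth_fan_def fan_def)

lemma fan_cone_hull: "\<sigma> \<in> \<Sigma> \<Longrightarrow> S \<subseteq> \<sigma> \<Longrightarrow> convex_cone hull S \<subseteq> \<sigma>"
  using \<Sigma> unfolding smooth_fan_def fan_def rational_polyhedral_cone_def
  by (metis convex_cone_convex_cone_hull hull_minimal)

text \<open>If a ray of the fan lies in \<sigma>, its intersection with \<sigma> is the ray itself,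
  which the intersection axiom makes a face. Rays can then be handled by mere membership.\<close>

lemma generating_rays_eq:
  assumes "\<sigma> \<in> \<Sigma>"
  shows "generating_rays \<rho> \<sigma> = {i. real_vec (\<rho> i) \<in> \<sigma>}"
proof (intro equalityI subsetI)
  fix i assume "i \<in> generating_rays \<rho> \<sigma>"
  then have "convex_cone hull {real_vec (\<rho> i)} \<subseteq> \<sigma>"
    by (auto simp: generating_rays_def cone_face_def dest: face_of_imp_subset)
  then show "i \<in> {i. real_vec (\<rho> i) \<in> \<sigma>}"
    using hull_inc[of "real_vec (\<rho> i)" "{real_vec (\<rho> i)}" convex_cone] by auto
next
  fix i assume "i \<in> {i. real_vec (\<rho> i) \<in> \<sigma>}"
  then have "convex_cone hull {real_vec (\<rho> i)} \<inter> \<sigma> = convex_cone hull {real_vec (\<rho> i)}"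
    using fan_cone_hull[OF assms] by auto
  moreover have "cone_face (convex_cone hull {real_vec (\<rho> i)} \<inter> \<sigma>) \<sigma>"
    using \<Sigma> ray_cone(1) assms unfolding smooth_fan_def fan_def by blast
  ultimately show "i \<in> generating_rays \<rho> \<sigma>"
    by (simp add: generating_rays_def)
qed

text \<open>Identifies the numbering of rays by \<rho> with the basis that smoothness provides: a
  basis vector spans a face and is primitive, hence is some ray generator; conversely every ray face
  comes from a basis vector.\<close>

lemma smooth_cone_basis:
  assumes "\<sigma> \<in> \<Sigma>"
  obtains \<beta> J where "lattice_basis \<beta>" "\<sigma> = convex_cone hull (real_vec ` \<beta> ` J)"
    "\<rho> ` generating_rays \<rho> \<sigma> = \<beta> ` J"
proof -
  obtain \<beta> J where \<beta>: "lattice_basis \<beta>" and \<sigma>: "\<sigma> = convex_cone hull (real_vec ` \<beta> ` J)"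
    using \<Sigma> assms unfolding smooth_fan_def smooth_cone_def by blast
  have "\<rho> ` generating_rays \<rho> \<sigma> = \<beta> ` J"
  proof (intro equalityI subsetI)
    fix v assume "v \<in> \<rho> ` generating_rays \<rho> \<sigma>"
    then show "v \<in> \<beta> ` J"
      using ray_face_of_basis_cone[OF \<beta> ray_cone(2)]
      by (auto simp: generating_rays_def cone_face_def \<sigma>)
  next
    fix v assume "v \<in> \<beta> ` J"
    then obtain j where j: "j \<in> J" "v = \<beta> j" by blast
    have face: "cone_face (convex_cone hull {real_vec (\<beta> j)}) \<sigma>"
      using basis_cone_face[OF \<beta>, of "{j}" J] j by (simp add: \<sigma>)
    then have "\<beta> j \<in> primitive_ray_generators \<Sigma>"
      using cone_face_mem[OF assms] lattice_basis_primitive[OF \<beta>]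
      by (simp add: primitive_ray_generators_def)
    then obtain i where "\<rho> i = \<beta> j" using \<rho> by (metis bij_betw_imp_surj_on imageE)
    with face j show "v \<in> \<rho> ` generating_rays \<rho> \<sigma>"
      by (auto simp: generating_rays_def intro!: image_eqI[of _ _ i])
  qed
  with \<beta> \<sigma> show thesis by (rule that)
qed

lemma cone_eq_hull_rays:
  "\<sigma> \<in> \<Sigma> \<Longrightarrow> \<sigma> = convex_cone hull (real_vec ` \<rho> ` generating_rays \<rho> \<sigma>)"
  by (metis smooth_cone_basis)

lemma dual_to_ray:
  assumes "\<sigma> \<in> \<Sigma>" "i \<in> generating_rays \<rho> \<sigma>"
  obtains m where "m \<in> M_lattice" "m (\<rho> i) = 1"
    "\<And>l. l \<in> generating_rays \<rho> \<sigma> \<Longrightarrow> l \<noteq> i \<Longrightarrow> m (\<rho> l) = 0"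
proof -
  obtain \<beta> J where \<beta>: "lattice_basis \<beta>" and G: "\<rho> ` generating_rays \<rho> \<sigma> = \<beta> ` J"
    using smooth_cone_basis[OF assms(1)] by metis
  then obtain j where j: "\<rho> i = \<beta> j" using assms(2) by blast
  show thesis
  proof (rule that)
    show "basis_coord \<beta> j \<in> M_lattice" by (rule basis_coord_M_lattice[OF \<beta>])
    show "basis_coord \<beta> j (\<rho> i) = 1" by (simp add: j basis_coord_basis[OF \<beta>])
    fix l assume l: "l \<in> generating_rays \<rho> \<sigma>" "l \<noteq> i"
    then obtain j' where "\<rho> l = \<beta> j'" using G by blast
    moreover have "\<rho> l \<noteq> \<rho> i" using l inj_rays by (meson injD)
    ultimately show "basis_coord \<beta> j (\<rho> l) = 0"
      using j by (auto simp: basis_coord_basis[OF \<beta>])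
  qed
qed

text \<open>The selected rays are part of a lattice basis, so their cone is a face of \<sigma>. It
  acquires no further rays: such a ray would be a basis vector of \<sigma> with coordinate 1, which
  forces its index into the selected part.\<close>

lemma subset_of_rays:
  assumes "\<sigma> \<in> \<Sigma>" "G \<subseteq> generating_rays \<rho> \<sigma>"
  defines "\<tau> \<equiv> convex_cone hull (real_vec ` \<rho> ` G)"
  shows "\<tau> \<in> \<Sigma>" "generating_rays \<rho> \<tau> = G" "dim \<tau> = card G"
proof -
  obtain \<beta> J where \<beta>: "lattice_basis \<beta>" and \<sigma>: "\<sigma> = convex_cone hull (real_vec ` \<beta> ` J)"
    and G\<sigma>: "\<rho> ` generating_rays \<rho> \<sigma> = \<beta> ` J"
    using smooth_cone_basis[OF assms(1)] by metis
  from assms(2) G\<sigma> have "\<rho> ` G \<subseteq> \<beta> ` J" by blast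
  then obtain J' where J': "J' \<subseteq> J" "\<rho> ` G = \<beta> ` J'" by (rule subset_imageE)
  then have \<tau>: "\<tau> = convex_cone hull (real_vec ` \<beta> ` J')" by (simp add: \<tau>_def)
  have face: "cone_face \<tau> \<sigma>" unfolding \<tau> \<sigma> by (rule basis_cone_face[OF \<beta> J'(1)])
  show \<tau>\<Sigma>: "\<tau> \<in> \<Sigma>" using cone_face_mem[OF assms(1) face] .
  show "generating_rays \<rho> \<tau> = G"
  proof (intro equalityI subsetI)
    fix i assume "i \<in> generating_rays \<rho> \<tau>"
    then have i: "real_vec (\<rho> i) \<in> \<tau>" using generating_rays_eq[OF \<tau>\<Sigma>] by simp
    then have "i \<in> generating_rays \<rho> \<sigma>"
      using face face_of_imp_subset unfolding cone_face_def generating_rays_eq[OF assms(1)] by blast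
    then obtain j where j: "j \<in> J" "\<rho> i = \<beta> j" using G\<sigma> by blast
    then have "coord \<beta> j (real_vec (\<rho> i)) \<noteq> 0" by (simp add: coord_basis[OF \<beta>])
    then have "j \<in> J'" using i unfolding \<tau> mem_basis_cone_iff[OF \<beta>] by blast
    then have "\<rho> i \<in> \<rho> ` G" using j J'(2) by auto
    then show "i \<in> G" using inj_rays by (simp add: inj_image_mem_iff)
  next
    fix i assume "i \<in> G"
    then have "real_vec (\<rho> i) \<in> \<tau>" unfolding \<tau>_def by (auto intro: hull_inc)
    then show "i \<in> generating_rays \<rho> \<tau>" using generating_rays_eq[OF \<tau>\<Sigma>] by simp
  qed
  have "card G = card (\<beta> ` J')"
    using card_image[OF inj_on_subset[OF inj_rays], of G] J'(2) by simp
  also have "\<dots> = card J'"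
    using card_image[OF inj_on_subset[OF lattice_basis_inj[OF \<beta>]], of J'] by simp
  finally show "dim \<tau> = card G" by (simp add: \<tau> dim_basis_cone[OF \<beta>])
qed

end

subsection \<open>Exchanging cones\<close>

theorem lemma2p20:
  fixes \<Sigma> :: "'n::{finite,linorder} cone set"
    and \<rho> :: "'d::finite \<Rightarrow> 'n lattice"
    and b :: "'n \<Rightarrow> 'd"
    and e :: "'n \<Rightarrow> 'n lattice \<Rightarrow> int"
    and \<gamma>1 \<sigma> \<gamma>2 :: "'n cone"
    and k :: nat
  assumes "smooth_fan \<Sigma>" and "complete_fan \<Sigma>"
    and "projective_variety (toric_variety \<Sigma>)"
    and "bij_betw \<rho> UNIV (primitive_ray_generators \<Sigma>)"
    and "lattice_basis (\<rho> \<circ> b)"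
    and "convex_cone hull (real_vec ` range (\<rho> \<circ> b)) \<in> \<Sigma>"
    and "\<And>j. e j \<in> M_lattice"
    and "\<And>j l. e j (\<rho> (b l)) = (if j = l then 1 else 0)"
    and "\<gamma>1 \<in> \<Sigma>" and "\<sigma> \<in> \<Sigma>" and "\<gamma>2 \<in> \<Sigma>"
    and "\<gamma>1 \<subset> \<sigma>" and "\<sigma> \<subseteq> \<gamma>2"
    and "k = dim \<sigma>"
  shows "\<exists>(r::nat) (\<sigma>s :: nat \<Rightarrow> 'n cone) (m :: nat \<Rightarrow> int).
    (\<forall>i<r. \<sigma>s i \<in> \<Sigma> \<and> dim (\<sigma>s i) = k \<and> \<gamma>1 \<subseteq> \<sigma>s i \<and> \<not> \<sigma>s i \<subseteq> \<gamma>2) \<and>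
    brieskorn_class \<Sigma> \<rho> e (cone_monomial \<rho> \<sigma>) =
      finprod (brieskorn_lattice \<Sigma> \<rho> e)
        (\<lambda>i. brieskorn_class \<Sigma> \<rho> e (cone_monomial \<rho> (\<sigma>s i)) [^]\<^bsub>brieskorn_lattice \<Sigma> \<rho> e\<^esub> m i)
        {..<r}"
proof -
  note fan = assms(1,4)
  let ?G = "generating_rays \<rho>"
  have sub: "?G \<gamma>1 \<subseteq> ?G \<sigma>" "?G \<sigma> \<subseteq> ?G \<gamma>2"
    using assms(9-13) by (auto simp: generating_rays_eq[OF fan])
  \<comment> \<open>Cones of the fan are determined by their rays, so strict inclusion of cones
    forces an additional ray.\<close>
  have "?G \<gamma>1 \<noteq> ?G \<sigma>"
    using cone_eq_hull_rays[OF fan assms(9)] cone_eq_hull_rays[OF fan assms(10)] assms(12) by auto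
  then obtain i0 where i0: "i0 \<in> ?G \<sigma>" "i0 \<notin> ?G \<gamma>1" using sub(1) by blast
  then have "i0 \<in> ?G \<gamma>2" using sub(2) by blast
  with fan assms(11) obtain m where m: "m \<in> M_lattice" "m (\<rho> i0) = 1"
    and m0: "\<And>l. l \<in> ?G \<gamma>2 \<Longrightarrow> l \<noteq> i0 \<Longrightarrow> m (\<rho> l) = 0"
    by (rule dual_to_ray) blast
  define T where "T = ?G \<sigma> - {i0}"
  have mT: "m (\<rho> i) = 0" if "i \<in> T" for i
    using m0 that sub(2) by (auto simp: T_def)
  \<comment> \<open>The complex knows only the frame attached to \<open>e\<close>, so
    \<open>m\<close> must be an integral combination of it. Since \<open>e\<close> is dual to the
    basis \<open>\<rho> \<circ> b\<close>, the coefficients are the values of \<open>m\<close> on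
    that basis.\<close>
  have expansion: "m v = (\<Sum>j\<in>UNIV. m (\<rho> (b j)) * e j v)" for v
  proof -
    let ?c = "\<lambda>j. basis_coord (\<rho> \<circ> b) j v"
    have v: "v = (\<Sum>j\<in>UNIV. ?c j *s \<rho> (b j))"
      using basis_coord_expansion[OF assms(5), of v] by simp
    have lin: "m' v = (\<Sum>j\<in>UNIV. ?c j * m' (\<rho> (b j)))" if "m' \<in> M_lattice" for m'
      using that additive_lattice_sum[of m' ?c "\<lambda>j. \<rho> (b j)" UNIV] v by (simp add: M_lattice_def)
    have "e j v = ?c j" for j
    proof -
      have "e j v = (\<Sum>l\<in>UNIV. ?c l * (if j = l then 1 else 0))"
        using lin[OF assms(7)[of j]] by (simp only: assms(8))
      also have "\<dots> = (\<Sum>l\<in>UNIV. if j = l then ?c l else 0)" by (rule sum.cong) auto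
      finally show ?thesis by simp
    qed
    then show ?thesis using lin[OF m(1)] by (simp add: mult.commute)
  qed
  \<comment> \<open>\<open>I\<close> collects the rays that span a cone together with
    \<open>T\<close>, \<open>D\<close> those whose monomial dies in the Stanley-Reisner ideal. The
    condition \<open>m (\<rho> i) \<noteq> 0\<close> silently excludes all rays of \<gamma>2 other
    than \<open>i0\<close>.\<close>
  define I where "I = {i. m (\<rho> i) \<noteq> 0 \<and> i \<noteq> i0 \<and> insert i T \<notin> SR_nonfaces \<Sigma> \<rho>}"
  define D where "D = {i. m (\<rho> i) \<noteq> 0 \<and> i \<noteq> i0 \<and> insert i T \<in> SR_nonfaces \<Sigma> \<rho>}"
  define \<tau> where "\<tau> i = convex_cone hull (real_vec ` \<rho> ` insert i T)" for i
  have notT: "i \<notin> T" if "m (\<rho> i) \<noteq> 0" for i using that mT by blast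
  have \<tau>: "\<tau> i \<in> \<Sigma> \<and> dim (\<tau> i) = k \<and> \<gamma>1 \<subseteq> \<tau> i \<and> \<not> \<tau> i \<subseteq> \<gamma>2"
    and mon: "cone_monomial \<rho> (\<tau> i) z = z $ i * (\<Prod>l\<in>T. z $ l)" if i: "i \<in> I" for i z
  proof -
    from i obtain \<kappa> where \<kappa>: "\<kappa> \<in> \<Sigma>" "\<forall>l\<in>insert i T. real_vec (\<rho> l) \<in> \<kappa>"
      by (auto simp: I_def SR_nonfaces_def)
    then have "insert i T \<subseteq> ?G \<kappa>" by (auto simp: generating_rays_eq[OF fan])
    note \<tau>i = subset_of_rays[OF fan \<kappa>(1) this, folded \<tau>_def]
    have iT: "i \<notin> T" using i notT by (auto simp: I_def)
    have "dim \<sigma> = card (?G \<sigma>)"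
      using subset_of_rays(3)[OF fan assms(10) subset_refl] cone_eq_hull_rays[OF fan assms(10)] by simp
    \<comment> \<open>Exchanging \<open>i0\<close> for a ray outside \<open>T\<close> preserves the
      number of rays, hence the dimension.\<close>
    also have "\<dots> = card (insert i T)"
      using iT i0(1) card_Suc_Diff1[of "?G \<sigma>" i0] by (simp add: T_def)
    finally have "dim (\<tau> i) = k" using \<tau>i(3) assms(14) by simp
    moreover have "?G \<gamma>1 \<subseteq> insert i T" using sub(1) i0(2) by (auto simp: T_def)
    then have "\<gamma>1 \<subseteq> \<tau> i"
      unfolding \<tau>_def by (subst cone_eq_hull_rays[OF fan assms(9)]) (intro hull_mono image_mono)
    moreover have "\<not> \<tau> i \<subseteq> \<gamma>2"
    proof
      assume "\<tau> i \<subseteq> \<gamma>2"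
      moreover have "real_vec (\<rho> i) \<in> \<tau> i" unfolding \<tau>_def by (rule hull_inc) simp
      ultimately have "i \<in> ?G \<gamma>2" by (auto simp: generating_rays_eq[OF fan assms(11)])
      then show False using m0 i by (auto simp: I_def)
    qed
    ultimately show "\<tau> i \<in> \<Sigma> \<and> dim (\<tau> i) = k \<and> \<gamma>1 \<subseteq> \<tau> i \<and> \<not> \<tau> i \<subseteq> \<gamma>2"
      using \<tau>i(1) by blast
    show "cone_monomial \<rho> (\<tau> i) z = z $ i * (\<Prod>l\<in>T. z $ l)"
      using iT by (simp add: cone_monomial_def \<tau>i(2))
  qed
  define g where "g z = (\<Prod>l\<in>T. z $ l) * (\<Sum>i\<in>UNIV. of_int (m (\<rho> i)) * z $ i)" for z :: "complex ^ 'd"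
  have g: "brieskorn_class \<Sigma> \<rho> e g = \<one>\<^bsub>brieskorn_lattice \<Sigma> \<rho> e\<^esub>"
    unfolding g_def[abs_def] using expansion mT by (intro brieskorn_class_relation)
  have holo_mon: "holomorphic_several (cone_monomial \<rho> \<kappa>) UNIV" for \<kappa>
    unfolding cone_monomial_def[abs_def] by (intro holomorphic_several_intros)
  \<comment> \<open>The claim indexes its cones by natural numbers, so the finite set
    \<open>I\<close> is enumerated.\<close>
  obtain en where en: "bij_betw en {..<card I} I"
    using ex_bij_betw_nat_finite[of I] by (auto simp: atLeast0LessThan)
  define s where "s z = (\<Sum>j<card I. of_int (- m (\<rho> (en j))) * cone_monomial \<rho> (\<tau> (en j)) z)"
    for z :: "complex ^ 'd"
  have s_eq: "s z = - (\<Sum>i\<in>I. of_int (m (\<rho> i)) * z $ i * (\<Prod>l\<in>T. z $ l))" for z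
  proof -
    have "s z = (\<Sum>i\<in>I. of_int (- m (\<rho> i)) * cone_monomial \<rho> (\<tau> i) z)"
      unfolding s_def by (rule sum.reindex_bij_betw[OF en])
    also have "\<dots> = (\<Sum>i\<in>I. - (of_int (m (\<rho> i)) * z $ i * (\<Prod>l\<in>T. z $ l)))"
      by (rule sum.cong) (simp_all add: mon)
    finally show ?thesis by (simp add: sum_negf)
  qed
  \<comment> \<open>An exact polynomial identity: the rays split into \<open>i0\<close>,
    \<open>I\<close>, \<open>D\<close> and those with coefficient zero. The part over
    \<open>D\<close> is the error that the ideal absorbs.\<close>
  have split: "cone_monomial \<rho> \<sigma> z - (g z + s z) =
      (\<Sum>i\<in>D. of_int (- m (\<rho> i)) * (\<Prod>l\<in>insert i T. z $ l))" for z
  proof -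
    let ?t = "\<lambda>i. of_int (m (\<rho> i)) * z $ i * (\<Prod>l\<in>T. z $ l)"
    have "g z = (\<Sum>i\<in>UNIV. ?t i)"
      by (simp add: g_def sum_distrib_left mult_ac)
    also have "\<dots> = (\<Sum>i\<in>insert i0 (I \<union> D). ?t i)"
      by (rule sum.mono_neutral_right) (auto simp: I_def D_def)
    also have "\<dots> = ?t i0 + (\<Sum>i\<in>I \<union> D. ?t i)"
      by (rule sum.insert) (auto simp: I_def D_def)
    also have "(\<Sum>i\<in>I \<union> D. ?t i) = (\<Sum>i\<in>I. ?t i) + (\<Sum>i\<in>D. ?t i)"
      by (rule sum.union_disjoint) (auto simp: I_def D_def)
    \<comment> \<open>The normalization \<open>m (\<rho> i0) = 1\<close> makes the coefficient of
      the monomial of \<sigma> a unit, so solving for it needs no division and the coefficients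
      remain integers.\<close>
    also have "?t i0 = cone_monomial \<rho> \<sigma> z"
      using i0(1) m(2) by (simp add: cone_monomial_def T_def prod.remove)
    also have "(\<Sum>i\<in>D. ?t i) = - (\<Sum>i\<in>D. of_int (- m (\<rho> i)) * (\<Prod>l\<in>insert i T. z $ l))"
      unfolding sum_negf[symmetric]
      by (rule sum.cong) (use notT in \<open>auto simp: D_def\<close>)
    finally show ?thesis by (simp add: s_eq)
  qed
  have "(\<lambda>z. cone_monomial \<rho> \<sigma> z - (g z + s z)) \<in> SR_ideal \<Sigma> \<rho> p" for p
    unfolding split
    by (intro SR_ideal_sum SR_ideal_mult germ_carrier_const SR_ideal_nonface) (simp add: D_def)
  then have "brieskorn_class \<Sigma> \<rho> e (cone_monomial \<rho> \<sigma>) = brieskorn_class \<Sigma> \<rho> e (\<lambda>z. g z + s z)"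
    by (rule brieskorn_class_cong_SR_ideal)
  also have "\<dots> = brieskorn_class \<Sigma> \<rho> e g \<otimes>\<^bsub>brieskorn_lattice \<Sigma> \<rho> e\<^esub> brieskorn_class \<Sigma> \<rho> e s"
    unfolding g_def[abs_def] s_def[abs_def]
    by (intro brieskorn_class_add holomorphic_several_intros holo_mon)
  also have "\<dots> = brieskorn_class \<Sigma> \<rho> e s"
  proof -
    interpret L: comm_group "brieskorn_lattice \<Sigma> \<rho> e" by (rule comm_group_brieskorn_lattice)
    have "holomorphic_several s UNIV"
      unfolding s_def[abs_def] by (intro holomorphic_several_intros holo_mon)
    then show ?thesis by (simp add: g brieskorn_class_closed)
  qed
  also have "\<dots> = finprod (brieskorn_lattice \<Sigma> \<rho> e)
      (\<lambda>j. brieskorn_class \<Sigma> \<rho> e (cone_monomial \<rho> (\<tau> (en j)))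
        [^]\<^bsub>brieskorn_lattice \<Sigma> \<rho> e\<^esub> (- m (\<rho> (en j)))) {..<card I}"
    unfolding s_def[abs_def] by (rule brieskorn_class_int_combination) (auto intro: holo_mon)
  finally have "brieskorn_class \<Sigma> \<rho> e (cone_monomial \<rho> \<sigma>) = \<dots>" .
  moreover have "\<forall>j<card I. \<tau> (en j) \<in> \<Sigma> \<and> dim (\<tau> (en j)) = k \<and> \<gamma>1 \<subseteq> \<tau> (en j) \<and> \<not> \<tau> (en j) \<subseteq> \<gamma>2"
    using \<tau> bij_betwE[OF en] by blast
  ultimately show ?thesis
    by (intro exI[of _ "card I"] exI[of _ "\<lambda>j. \<tau> (en j)"] exI[of _ "\<lambda>j. - m (\<rho> (en j))"] conjI)
qed

end
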